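(* Let $b$ be any polynomial. There is a deterministic algorithm which, given an $n\times n$ matrix $M$ whose entries are integers of bit-length at most $b(n)$, computes the permanent $\operatorname{per}(M)=\sum_{\sigma\in S_n}\prod_{i=1}^n M_{i,\sigma(i)}$ in time $2^{\,n-\Omega(\sqrt{n/\log n})}$.
   Context: $S_n$ denotes the set of all permutations of $\{1,\dots,n\}$. The integer entries may be negative. *)

theory Defs
  imports
    "HOL-Computational_Algebra.Polynomial"
    "HOL-Combinatorics.Permutations"
    "HOL-Library.Log_Nat"
    "HOL-Library.Landau_Symbols"
    "Jordan_Normal_Form.Matrix"
begin

section \<open>The permanent\<close>

definition permanent :: "int mat \<Rightarrow> int" where
  "permanent M = (\<Sum>\<sigma> \<in> {\<sigma>. \<sigma> permutes {0..<dim_row M}}. \<Prod>i = 0..<dim_row M. M $$ (i, \<sigma> i))"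

section \<open>Algorithms: random access machine programs with logarithmic cost\<close>

text \<open>
  Algorithms are programs for a random access machine over the integers, written as
  while-programs. The machine has registers, of which a program mentions finitely many, and
  a memory with computed addresses. Every operation is charged by the bit-length of its
  operands (logarithmic cost criterion), so that time is the number of bit operations up to
  polynomial factors in the bit-length of the numbers handled; unit cost would be unsound as a
  measure of time because multiplication can build numbers of exponential length.
\<close>

datatype expr =
    Const int
  | Reg nat
  | Load expr
  | Plus expr expr
  | Minus expr expr
  | Times expr expr
  | Divide expr expr
  | Modulo expr expr
  | Less expr expr
  | Equal expr expr

datatype prog =
    Skip
  | Assign nat expr
  | Store expr expr
  | Seq prog prog
  | Cond expr prog prog
  | While expr prog

type_synonym state = "(nat \<Rightarrow> int) \<times> (int \<Rightarrow> int)"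

fun eval :: "state \<Rightarrow> expr \<Rightarrow> int" where
  "eval s (Const k) = k"
| "eval s (Reg r) = fst s r"
| "eval s (Load a) = snd s (eval s a)"
| "eval s (Plus a b) = eval s a + eval s b"
| "eval s (Minus a b) = eval s a - eval s b"
| "eval s (Times a b) = eval s a * eval s b"
| "eval s (Divide a b) = eval s a div eval s b"
| "eval s (Modulo a b) = eval s a mod eval s b"
| "eval s (Less a b) = (if eval s a < eval s b then 1 else 0)"
| "eval s (Equal a b) = (if eval s a = eval s b then 1 else 0)"

text \<open>The length of a number includes one sign bit, so it is never 0.\<close>

definition len :: "int \<Rightarrow> nat" where
  "len x = nat (bitlen \<bar>x\<bar>) + 1"

text \<open>
  Linear cost for access, addition and comparison; quadratic (schoolbook) cost for
  multiplication and division.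
\<close>

fun cost :: "state \<Rightarrow> expr \<Rightarrow> nat" where
  "cost s (Const k) = len k"
| "cost s (Reg r) = len (fst s r)"
| "cost s (Load a) = cost s a + len (eval s a) + len (snd s (eval s a))"
| "cost s (Plus a b) = cost s a + cost s b + len (eval s a) + len (eval s b)"
| "cost s (Minus a b) = cost s a + cost s b + len (eval s a) + len (eval s b)"
| "cost s (Times a b) = cost s a + cost s b + len (eval s a) * len (eval s b)"
| "cost s (Divide a b) = cost s a + cost s b + len (eval s a) * len (eval s b)"
| "cost s (Modulo a b) = cost s a + cost s b + len (eval s a) * len (eval s b)"
| "cost s (Less a b) = cost s a + cost s b + len (eval s a) + len (eval s b)"
| "cost s (Equal a b) = cost s a + cost s b + len (eval s a) + len (eval s b)"

text \<open>\<open>exec P s t s'\<close>: started in \<open>s\<close>, the program \<open>P\<close> halts in \<open>s'\<close> after time \<open>t\<close>.\<close>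

inductive exec :: "prog \<Rightarrow> state \<Rightarrow> nat \<Rightarrow> state \<Rightarrow> bool" where
  Skip: "exec Skip s 1 s"
| Assign: "exec (Assign r e) s (cost s e + len (eval s e)) ((fst s)(r := eval s e), snd s)"
| Store: "exec (Store a e) s (cost s a + cost s e + len (eval s a) + len (eval s e))
            (fst s, (snd s)(eval s a := eval s e))"
| Seq: "exec P s t s' \<Longrightarrow> exec Q s' u s'' \<Longrightarrow> exec (Seq P Q) s (t + u) s''"
| CondTrue: "eval s e \<noteq> 0 \<Longrightarrow> exec P s t s' \<Longrightarrow> exec (Cond e P Q) s (cost s e + t) s'"
| CondFalse: "eval s e = 0 \<Longrightarrow> exec Q s t s' \<Longrightarrow> exec (Cond e P Q) s (cost s e + t) s'"
| WhileFalse: "eval s e = 0 \<Longrightarrow> exec (While e P) s (cost s e) s"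
| WhileTrue: "eval s e \<noteq> 0 \<Longrightarrow> exec P s t s' \<Longrightarrow> exec (While e P) s' u s'' \<Longrightarrow>
    exec (While e P) s (cost s e + t + u) s''"

inductive_cases exec_SkipE: "exec Skip s t s'"
  and exec_AssignE: "exec (Assign r e) s t s'"
  and exec_StoreE: "exec (Store a e) s t s'"
  and exec_SeqE: "exec (Seq P Q) s t s'"
  and exec_CondE: "exec (Cond e P Q) s t s'"
  and exec_WhileE: "exec (While e P) s t s'"

text \<open>Programs are deterministic: result and running time are functions of the initial state.\<close>

lemma exec_deterministic:
  "exec P s t s' \<Longrightarrow> exec P s u s'' \<Longrightarrow> t = u \<and> s' = s''"
proof (induction arbitrary: u s'' rule: exec.induct)
  case (Seq P s t s' Q v s2)
  then show ?case by (metis exec_SeqE)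
next
  case (CondTrue s e P t s' Q)
  then show ?case by (metis exec_CondE)
next
  case (CondFalse s e Q t s' P)
  then show ?case by (metis exec_CondE)
next
  case (WhileFalse s e P)
  then show ?case by (metis exec_WhileE)
next
  case (WhileTrue s e P t s' v s2)
  from WhileTrue.prems WhileTrue.hyps(1) obtain t1 s1 u1 where
    "exec P s t1 s1" "exec (While e P) s1 u1 s''" "u = cost s e + t1 + u1"
    by (auto elim: exec_WhileE)
  then show ?case using WhileTrue.IH by metis
qed (auto elim: exec_SkipE exec_AssignE exec_StoreE)

text \<open>
  An \<open>n \<times> n\<close> matrix is presented with \<open>n\<close> in register 0 and the entries in row-major order in
  the memory cells \<open>0, \<dots>, n\<^sup>2 - 1\<close>; all other registers and cells are 0. The answer is the
  content of register 0 at termination.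
\<close>

definition input_state :: "nat \<Rightarrow> int mat \<Rightarrow> state" where
  "input_state n M =
     (\<lambda>r. if r = 0 then int n else 0,
      \<lambda>a. if 0 \<le> a \<and> a < int n * int n then M $$ (nat a div n, nat a mod n) else 0)"

definition result :: "state \<Rightarrow> int" where
  "result s = fst s 0"

end

theory Submission
  imports Defs "HOL-Number_Theory.Cong" "HOL-Real_Asymp.Real_Asymp"
begin

text \<open>
  If the last row and column of a matrix with blocks \<open>D\<close>, \<open>b\<close>, \<open>c\<close>, \<open>a\<close> are split off, then its
  permanent is the coefficient of \<open>x\<close> in \<open>(1 + a x) per (D + x b c)\<close>: a permutation either fixes the
  last index or routes exactly one \<open>u \<mapsto> v\<close> through it. Eliminating \<open>n - k\<close> indices in this way, each
  with its own variable, turns the permanent into the coefficient of the product of all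
  variables in a factor times a \<open>k \<times> k\<close> permanent. This coefficient is extracted by
  inclusion-exclusion over the substitutions of \<open>0\<close> or \<open>Z\<close> for the variables, computing
  modulo \<open>Z ^ (n - k + 1)\<close> for an integer \<open>Z\<close> that exceeds twice the absolute value of the permanent:
  the sum of the \<open>2 ^ (n - k)\<close> terms is \<open>Z ^ (n - k)\<close> times the permanent.

  Each of the \<open>k \<times> k\<close> permanents has polynomially many bits. It is found by Chinese
  remaindering from its residues modulo all numbers below some \<open>X\<close> polynomial in \<open>n\<close>, whose least
  common multiple is at least \<open>2 ^ (X - 3)\<close>, and for the residues a table of the permanents of all
  \<open>k \<times> k\<close> matrices with entries below \<open>X\<close> is used. With \<open>k\<close> of order \<open>sqrt (n / log n)\<close> the table has
  at most \<open>2 ^ (n / 2)\<close> entries. They are computed by the same elimination with \<open>k = 0\<close>.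
\<close>

section \<open>Elimination of indices from a permanent\<close>

text \<open>The gain is that the outer sum has only \<open>2 ^ (n - k)\<close> terms, provided that
  each remaining \<open>k\<close> by \<open>k\<close> permanent takes polynomial time. A table
  achieves this only if the matrix entries come from a small alphabet, whereas elimination produces
  entries with polynomially many bits; residues modulo small numbers bridge that gap. For an
  alphabet of polynomial size \<open>X\<close> the table has \<open>X ^ (k * k)\<close> entries, so
  \<open>k * k * log n\<close> must stay below a fraction of \<open>n\<close>. This limits
  \<open>k\<close>, and hence the gain in the exponent. An integer \<open>Z\<close> in place of
  formal variables packs a truncated polynomial into a single number, so that no polynomial
  arithmetic is programmed. Taking all moduli below \<open>X\<close> avoids both primality tests and
  prime number estimates; the price is remaindering with moduli that are not coprime, done by linear
  search, which is cheap because the moduli are small. All polynomial overhead, including the cost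
  of long numbers, ends up as a term \<open>E * log 2 (n + 2)\<close> in the exponent, of lower
  order than \<open>k\<close>.\<close>

definition perm :: "nat \<Rightarrow> (nat \<Rightarrow> nat \<Rightarrow> int) \<Rightarrow> int" where
  "perm n W = (\<Sum>\<sigma> | \<sigma> permutes {..<n}. \<Prod>i<n. W i (\<sigma> i))"

lemma perm_0 [simp]: "perm 0 W = 1"
  by (simp add: perm_def)

lemma perm_eqI: "(\<And>u v. u < n \<Longrightarrow> v < n \<Longrightarrow> W u v = W' u v) \<Longrightarrow> perm n W = perm n W'"
  unfolding perm_def by (intro sum.cong prod.cong refl) (auto dest: permutes_in_image)

lemma permanent_eq_perm: "M \<in> carrier_mat n n \<Longrightarrow> permanent M = perm n (\<lambda>i j. M $$ (i, j))"
  by (auto simp: permanent_def perm_def atLeast0LessThan)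

text \<open>A permutation of \<open>{..<Suc j}\<close> is a permutation \<open>\<tau>\<close> of
  \<open>{..<j}\<close> followed by a transposition of \<open>j\<close> with some \<open>b\<close>.
  For \<open>b = j\<close> the index \<open>j\<close> stays fixed; for \<open>b = \<tau> u\<close>
  the arrow from \<open>u\<close> to \<open>\<tau> u\<close> is rerouted through
  \<open>j\<close>.\<close>

lemma perm_Suc:
  "perm (Suc j) W = W j j * perm j W +
     (\<Sum>\<tau> | \<tau> permutes {..<j}. \<Sum>u<j. W u j * W j (\<tau> u) * (\<Prod>i\<in>{..<j} - {u}. W i (\<tau> i)))"
proof -
  let ?f = "\<lambda>\<sigma>. \<Prod>i<Suc j. W i (\<sigma> i)"
  have "perm (Suc j) W = sum ?f {\<sigma>. \<sigma> permutes (insert j {..<j})}"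
    by (simp add: perm_def lessThan_Suc)
  also have "\<dots> = (\<Sum>b\<in>insert j {..<j}. \<Sum>\<tau> | \<tau> permutes {..<j}. ?f (transpose j b \<circ> \<tau>))"
    by (rule sum_over_permutations_insert) auto
  also have "\<dots> = (\<Sum>\<tau> | \<tau> permutes {..<j}. \<Sum>b\<in>insert j {..<j}. ?f (transpose j b \<circ> \<tau>))"
    by (rule sum.swap)
  also have "\<dots> = (\<Sum>\<tau> | \<tau> permutes {..<j}. W j j * (\<Prod>i<j. W i (\<tau> i)) +
       (\<Sum>u<j. W u j * W j (\<tau> u) * (\<Prod>i\<in>{..<j} - {u}. W i (\<tau> i))))"
  proof (rule sum.cong[OF refl])
    fix \<tau> assume "\<tau> \<in> {\<tau>. \<tau> permutes {..<j}}"
    then have tau: "\<tau> permutes {..<j}" by simp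
    have tj: "\<tau> j = j" using tau by (simp add: permutes_def)
    have lt: "\<tau> i < j" if "i < j" for i using permutes_in_image[OF tau, of i] that by simp
    have 1: "?f (transpose j j \<circ> \<tau>) = W j j * (\<Prod>i<j. W i (\<tau> i))"
      by (simp add: tj mult.commute)
    have 2: "?f (transpose j (\<tau> u) \<circ> \<tau>) = W u j * W j (\<tau> u) * (\<Prod>i\<in>{..<j} - {u}. W i (\<tau> i))"
      if "u < j" for u
    proof -
      have "(\<Prod>i<j. W i ((transpose j (\<tau> u) \<circ> \<tau>) i)) =
          W u j * (\<Prod>i\<in>{..<j} - {u}. W i ((transpose j (\<tau> u) \<circ> \<tau>) i))"
        using that by (subst prod.remove[of _ u]) auto
      also have "(\<Prod>i\<in>{..<j} - {u}. W i ((transpose j (\<tau> u) \<circ> \<tau>) i)) =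
          (\<Prod>i\<in>{..<j} - {u}. W i (\<tau> i))"
      proof (rule prod.cong[OF refl])
        fix i assume i: "i \<in> {..<j} - {u}"
        then have "\<tau> i \<noteq> \<tau> u" using permutes_inj[OF tau] by (auto dest: injD)
        moreover have "\<tau> i \<noteq> j" using lt[of i] i by auto
        ultimately show "W i ((transpose j (\<tau> u) \<circ> \<tau>) i) = W i (\<tau> i)"
          by (simp add: transpose_def)
      qed
      finally show ?thesis by (simp add: tj)
    qed
    \<comment> \<open>Substituting \<open>b = \<tau> u\<close> sums over the row \<open>u\<close>
      that is rerouted instead of over its target.\<close>
    have "(\<Sum>b<j. ?f (transpose j b \<circ> \<tau>)) = (\<Sum>u<j. ?f (transpose j (\<tau> u) \<circ> \<tau>))"
      by (rule sum.permute[OF tau, unfolded o_def])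
    also have "\<dots> = (\<Sum>u<j. W u j * W j (\<tau> u) * (\<Prod>i\<in>{..<j} - {u}. W i (\<tau> i)))"
      by (rule sum.cong) (use 2 in auto)
    finally show "(\<Sum>b\<in>insert j {..<j}. ?f (transpose j b \<circ> \<tau>)) = W j j * (\<Prod>i<j. W i (\<tau> i)) +
       (\<Sum>u<j. W u j * W j (\<tau> u) * (\<Prod>i\<in>{..<j} - {u}. W i (\<tau> i)))"
      using 1 by (simp del: prod.lessThan_Suc)
  qed
  finally show ?thesis by (simp add: sum.distrib perm_def sum_distrib_left)
qed

text \<open>
  Integer polynomials in the matrix entries, represented by their value functions. They provide the
  remainder terms of expansions in powers of \<open>Z\<close>: a mere congruence modulo a power of \<open>Z\<close>
  would not survive the induction in \<open>sum_contrib\<close>, which divides by \<open>Z\<close> in every step.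
\<close>

inductive polyfun :: "((nat \<Rightarrow> nat \<Rightarrow> int) \<Rightarrow> int) \<Rightarrow> bool" where
  const: "polyfun (\<lambda>W. c)"
| var: "polyfun (\<lambda>W. W u v)"
| add: "polyfun f \<Longrightarrow> polyfun g \<Longrightarrow> polyfun (\<lambda>W. f W + g W)"
| mult: "polyfun f \<Longrightarrow> polyfun g \<Longrightarrow> polyfun (\<lambda>W. f W * g W)"

lemmas [simp] = polyfun.intros

lemma polyfun_sum [simp]: "(\<And>a. a \<in> A \<Longrightarrow> polyfun (f a)) \<Longrightarrow> polyfun (\<lambda>W. \<Sum>a\<in>A. f a W)"
  by (induction A rule: infinite_finite_induct) auto

lemma polyfun_prod [simp]: "(\<And>a. a \<in> A \<Longrightarrow> polyfun (f a)) \<Longrightarrow> polyfun (\<lambda>W. \<Prod>a\<in>A. f a W)"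
  by (induction A rule: infinite_finite_induct) auto

text \<open>A Taylor expansion to order zero whose remainder is again an integer polynomial. The
  shift \<open>N\<close> may depend on \<open>W\<close>, as the update in \<open>estep\<close>
  does.\<close>

lemma polyfun_shift:
  assumes "polyfun f" and N: "\<And>u v. polyfun (\<lambda>W. N W u v)"
  shows "\<exists>g. polyfun g \<and> (\<forall>W. f (\<lambda>u v. W u v + Z * N W u v) = f W + Z * g W)"
  using assms(1)
proof induction
  case (const c)
  show ?case by (rule exI[of _ "\<lambda>W. 0"]) auto
next
  case (var u v)
  show ?case using N by (intro exI[of _ "\<lambda>W. N W u v"]) auto
next
  case (add f g)
  then obtain f' g' where "polyfun f'" "polyfun g'"
    "\<forall>W. f (\<lambda>u v. W u v + Z * N W u v) = f W + Z * f' W"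
    "\<forall>W. g (\<lambda>u v. W u v + Z * N W u v) = g W + Z * g' W" by blast
  then show ?case by (intro exI[of _ "\<lambda>W. f' W + g' W"]) (auto simp: algebra_simps)
next
  case (mult f g)
  then obtain f' g' where "polyfun f'" "polyfun g'"
    "\<forall>W. f (\<lambda>u v. W u v + Z * N W u v) = f W + Z * f' W"
    "\<forall>W. g (\<lambda>u v. W u v + Z * N W u v) = g W + Z * g' W" by blast
  with mult show ?case
    by (intro exI[of _ "\<lambda>W. f W * g' W + f' W * g W + Z * (f' W * g' W)"]) (auto simp: algebra_simps)
qed

text \<open>The product rule with a quadratic remainder. Applied to the product of one permutation,
  its linear term singles out the row that is rerouted.\<close>

lemma prod_first_order:
  assumes "finite A" "\<And>i. i \<in> A \<Longrightarrow> polyfun (f i)" "\<And>i. i \<in> A \<Longrightarrow> polyfun (g i)"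
  shows "\<exists>R. polyfun R \<and> (\<forall>W. (\<Prod>i\<in>A. f i W + Z * g i W) =
    (\<Prod>i\<in>A. f i W) + Z * (\<Sum>u\<in>A. g u W * (\<Prod>i\<in>A - {u}. f i W)) + Z\<^sup>2 * R W)"
  using assms
proof (induction A rule: finite_induct)
  case empty
  show ?case by (rule exI[of _ "\<lambda>W. 0"]) auto
next
  case (insert a A)
  have "\<exists>R. polyfun R \<and> (\<forall>W. (\<Prod>i\<in>A. f i W + Z * g i W) =
    (\<Prod>i\<in>A. f i W) + Z * (\<Sum>u\<in>A. g u W * (\<Prod>i\<in>A - {u}. f i W)) + Z\<^sup>2 * R W)"
    by (rule insert.IH) (use insert.prems in blast)+
  then obtain R where R: "polyfun R" "\<And>W. (\<Prod>i\<in>A. f i W + Z * g i W) =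
    (\<Prod>i\<in>A. f i W) + Z * (\<Sum>u\<in>A. g u W * (\<Prod>i\<in>A - {u}. f i W)) + Z\<^sup>2 * R W"
    by blast
  define D where "D W = (\<Sum>u\<in>A. g u W * (\<Prod>i\<in>A - {u}. f i W))" for W
  have D: "polyfun D" unfolding D_def 
    by (intro polyfun_sum polyfun.mult polyfun_prod insert.prems) auto
  have e: "(\<Sum>u\<in>insert a A. g u W * (\<Prod>i\<in>insert a A - {u}. f i W)) =
      g a W * (\<Prod>i\<in>A. f i W) + f a W * D W" for W
  proof -
    have "(\<Sum>u\<in>A. g u W * (\<Prod>i\<in>insert a A - {u}. f i W)) = f a W * D W"
      unfolding D_def sum_distrib_left
    proof (rule sum.cong[OF refl])
      fix u assume u: "u \<in> A"
      then have "insert a A - {u} = insert a (A - {u})" using insert.hyps by auto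
      then show "g u W * (\<Prod>i\<in>insert a A - {u}. f i W) = f a W * (g u W * (\<Prod>i\<in>A - {u}. f i W))"
        using insert.hyps by (simp add: algebra_simps)
    qed
    then show ?thesis using insert.hyps by simp
  qed
  have fa: "polyfun (f a)" "polyfun (g a)" using insert.prems by auto
  have "(\<Prod>i\<in>insert a A. f i W + Z * g i W) = (\<Prod>i\<in>insert a A. f i W) +
      Z * (\<Sum>u\<in>insert a A. g u W * (\<Prod>i\<in>insert a A - {u}. f i W)) +
      Z\<^sup>2 * (f a W * R W + g a W * D W + Z * (g a W * R W))" for W
    unfolding e prod.insert[OF insert.hyps] R(2)[folded D_def]
    by (simp add: algebra_simps power2_eq_square)
  moreover have "polyfun (\<lambda>W. f a W * R W + g a W * D W + Z * (g a W * R W))"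
    by (intro polyfun.intros fa R(1) D)
  ultimately show ?case by blast
qed

text \<open>The block \<open>D + x b c\<close> at \<open>x = Z\<close>: a rank-one update by column
  \<open>j\<close> and row \<open>j\<close>.\<close>

definition estep :: "int \<Rightarrow> nat \<Rightarrow> (nat \<Rightarrow> nat \<Rightarrow> int) \<Rightarrow> nat \<Rightarrow> nat \<Rightarrow> int" where
  "estep Z j W = (\<lambda>u v. W u v + Z * (W u j * W j v))"

text \<open>The linear coefficient is the rerouting sum of \<open>perm_Suc\<close>, that is,
  \<open>perm (Suc j) W\<close> without its fixed-point part. The factor
  \<open>1 + Z * W j j\<close> in \<open>contrib\<close> restores that part up to multiples of
  \<open>Z\<^sup>2\<close>.\<close>

lemma perm_estep:
  "\<exists>R. polyfun R \<and> (\<forall>W. perm j (estep Z j W) =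
     perm j W + Z * (perm (Suc j) W - W j j * perm j W) + Z\<^sup>2 * R W)"
proof -
  have "\<forall>\<tau>. \<exists>R. polyfun R \<and> (\<forall>W. (\<Prod>i<j. W i (\<tau> i) + Z * (W i j * W j (\<tau> i))) =
    (\<Prod>i<j. W i (\<tau> i)) + Z * (\<Sum>u<j. (W u j * W j (\<tau> u)) * (\<Prod>i\<in>{..<j} - {u}. W i (\<tau> i))) + Z\<^sup>2 * R W)"
    by (intro allI prod_first_order) (rule finite_lessThan polyfun.intros)+
  then obtain R where "\<forall>\<tau>. polyfun (R \<tau>) \<and> (\<forall>W. (\<Prod>i<j. W i (\<tau> i) + Z * (W i j * W j (\<tau> i))) =
    (\<Prod>i<j. W i (\<tau> i)) + Z * (\<Sum>u<j. (W u j * W j (\<tau> u)) * (\<Prod>i\<in>{..<j} - {u}. W i (\<tau> i))) + Z\<^sup>2 * R \<tau> W)"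
    by (rule choice[THEN exE])
  then have R: "polyfun (R \<tau>)" "(\<Prod>i<j. W i (\<tau> i) + Z * (W i j * W j (\<tau> i))) =
    (\<Prod>i<j. W i (\<tau> i)) + Z * (\<Sum>u<j. (W u j * W j (\<tau> u)) * (\<Prod>i\<in>{..<j} - {u}. W i (\<tau> i))) + Z\<^sup>2 * R \<tau> W"
    for \<tau> W by blast+
  have "perm j (estep Z j W) = perm j W + Z * (perm (Suc j) W - W j j * perm j W) +
      Z\<^sup>2 * (\<Sum>\<tau> | \<tau> permutes {..<j}. R \<tau> W)" for W
    unfolding perm_Suc
    unfolding perm_def estep_def R(2) sum.distrib sum_distrib_left[symmetric] by simp
  moreover have "polyfun (\<lambda>W. \<Sum>\<tau> | \<tau> permutes {..<j}. R \<tau> W)"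
    by (intro polyfun_sum R(1))
  ultimately show ?thesis by blast
qed

lemma polyfun_perm [simp]: "polyfun (perm n)"
  unfolding perm_def by auto

text \<open>
  The summand of the inclusion-exclusion formula that belongs to the subset of
  \<open>{K..<K + d}\<close> encoded by the bits of \<open>t\<close>; the lowest bit stands for the largest index.
\<close>

fun contrib :: "int \<Rightarrow> nat \<Rightarrow> nat \<Rightarrow> nat \<Rightarrow> (nat \<Rightarrow> nat \<Rightarrow> int) \<Rightarrow> int" where
  "contrib Z K 0 t W = perm K W"
| "contrib Z K (Suc d) t W =
    (if odd t then (1 + Z * W (K + d) (K + d)) * contrib Z K d (t div 2) (estep Z (K + d) W)
     else - contrib Z K d (t div 2) W)"

lemma sum_lessThan_double: "(\<Sum>t<2 * (n::nat). f t) = (\<Sum>t<n. f (2 * t) + f (Suc (2 * t)))"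
  for f :: "nat \<Rightarrow> int"
  by (induction n) auto

text \<open>Even and odd \<open>t\<close> are the subsets without and with the index
  \<open>K + d\<close>.\<close>

lemma sum_contrib_Suc:
  "(\<Sum>t<2 ^ Suc d. contrib Z K (Suc d) t W) =
     (1 + Z * W (K + d) (K + d)) * (\<Sum>t<2 ^ d. contrib Z K d t (estep Z (K + d) W))
     - (\<Sum>t<2 ^ d. contrib Z K d t W)"
  by (simp add: sum_lessThan_double sum.distrib sum_negf sum_distrib_left sum_subtractf)

text \<open>Each difference between substituting \<open>Z\<close> and \<open>0\<close> cancels the
  constant term in one variable and so gains one factor \<open>Z\<close>. The remainder
  \<open>E\<close> is differenced as well, and \<open>polyfun_shift\<close> supplies the factor
  \<open>Z\<close> there.\<close>

lemma sum_contrib: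
  "\<exists>E. polyfun E \<and> (\<forall>W. (\<Sum>t<2 ^ d. contrib Z K d t W) = Z ^ d * (perm (K + d) W + Z * E W))"
proof (induction d)
  case 0
  show ?case by (rule exI[of _ "\<lambda>W. 0"]) auto
next
  case (Suc d)
  define j where "j = K + d"
  from Suc obtain E where E: "polyfun E"
    "\<And>W. (\<Sum>t<2 ^ d. contrib Z K d t W) = Z ^ d * (perm j W + Z * E W)" unfolding j_def by auto
  obtain R where R: "polyfun R" "\<And>W. perm j (estep Z j W) =
     perm j W + Z * (perm (Suc j) W - W j j * perm j W) + Z\<^sup>2 * R W"
    using perm_estep by blast
  have "\<exists>G. polyfun G \<and> (\<forall>W. E (estep Z j W) = E W + Z * G W)"
    unfolding estep_def by (rule polyfun_shift[OF E(1)]) auto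
  then obtain G where G: "polyfun G" "\<And>W. E (estep Z j W) = E W + Z * G W" by blast
  \<comment> \<open>Obtained by expanding both sums: \<open>?F\<close> is what is left, divided by
    \<open>Z ^ (d + 2)\<close>, once \<open>Z ^ Suc d * perm (K + Suc d) W\<close> is taken
    out.\<close>
  let ?F = "\<lambda>W. R W + (G W + W j j * (perm (Suc j) W + (- 1) * (W j j * perm j W) +
     Z * R W + E W + Z * G W))"
  have "polyfun ?F" by (intro polyfun.intros R G E polyfun_perm)
  moreover have "(\<Sum>t<2 ^ Suc d. contrib Z K (Suc d) t W) =
      Z ^ Suc d * (perm (K + Suc d) W + Z * ?F W)" for W
    unfolding sum_contrib_Suc E(2) j_def[symmetric] R(2) G(2)
    by (simp add: j_def[symmetric] algebra_simps power2_eq_square)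
  ultimately show ?case by blast
qed

lemma sum_contrib_mod:
  assumes "Z > 0"
  shows "((\<Sum>t<2 ^ d. contrib Z K d t W) mod Z ^ Suc d) div Z ^ d = perm (K + d) W mod Z"
proof -
  obtain E where "(\<Sum>t<2 ^ d. contrib Z K d t W) = Z ^ d * (perm (K + d) W + Z * E W)"
    using sum_contrib by blast
  then have "(\<Sum>t<2 ^ d. contrib Z K d t W) mod Z ^ Suc d = Z ^ d * (perm (K + d) W mod Z)"
    by (simp add: mult_mod_right[symmetric] mult.commute[of Z])
  then show ?thesis using assms by simp
qed

section \<open>Congruences and size bounds for permanents\<close>

lemma perm_cong:
  assumes "\<And>u v. u < n \<Longrightarrow> v < n \<Longrightarrow> [W u v = W' u v] (mod q)"
  shows "[perm n W = perm n W'] (mod q)"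
  unfolding perm_def
  by (intro cong_sum cong_prod assms) (auto dest: permutes_in_image)

text \<open>This permits reducing all entries between elimination steps, which keeps the numbers
  short.\<close>

lemma contrib_cong:
  assumes "\<And>u v. u < K + d \<Longrightarrow> v < K + d \<Longrightarrow> [W u v = W' u v] (mod q)"
  shows "[contrib Z K d t W = contrib Z K d t W'] (mod q)"
  using assms
proof (induction d arbitrary: t W W')
  case 0
  then show ?case by (auto intro: perm_cong)
next
  case (Suc d)
  have a: "[contrib Z K d t' (estep Z (K + d) W) = contrib Z K d t' (estep Z (K + d) W')] (mod q)" for t'
    by (rule Suc.IH, unfold estep_def, intro cong_add cong_mult Suc.prems) auto
  have b: "[contrib Z K d t' W = contrib Z K d t' W'] (mod q)" for t'
    by (rule Suc.IH) (auto intro: Suc.prems)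
  have c: "[W (K+d) (K+d) = W' (K+d) (K+d)] (mod q)" by (rule Suc.prems) auto
  show ?case using a b c by (auto intro!: cong_mult cong_add simp: cong_minus_minus_iff)
qed

lemma perm_abs_le:
  assumes "\<And>u v. u < n \<Longrightarrow> v < n \<Longrightarrow> \<bar>W u v\<bar> \<le> C"
  shows "\<bar>perm n W\<bar> \<le> fact n * C ^ n"
proof -
  have "\<bar>perm n W\<bar> \<le> (\<Sum>\<sigma> | \<sigma> permutes {..<n}. \<bar>\<Prod>i<n. W i (\<sigma> i)\<bar>)"
    unfolding perm_def by (rule sum_abs)
  also have "\<dots> \<le> (\<Sum>\<sigma> | \<sigma> permutes {..<n}. C ^ n)"
  proof (rule sum_mono)
    fix \<sigma> assume "\<sigma> \<in> {\<sigma>. \<sigma> permutes {..<n}}"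
    then have "\<sigma> i < n" if "i < n" for i using permutes_in_image[of \<sigma> "{..<n}" i] that by simp
    then have "(\<Prod>i<n. \<bar>W i (\<sigma> i)\<bar>) \<le> (\<Prod>i<n. C)" using assms by (intro prod_mono) auto
    then show "\<bar>\<Prod>i<n. W i (\<sigma> i)\<bar> \<le> C ^ n" by (simp add: abs_prod)
  qed
  also have "\<dots> = fact n * C ^ n"
    using card_permutations[of "{..<n}" n] by simp
  finally show ?thesis .
qed

text \<open>Crude, but with powers of two all later size estimates become comparisons of
  exponents.\<close>

lemma fact_le_two_pow: "(fact k :: int) \<le> 2 ^ (k * k)"
proof -
  have "(fact k :: nat) \<le> k ^ k" by (metis fact_le_power of_nat_id)
  also have "\<dots> \<le> (2 ^ k) ^ k" by (intro power_mono) (simp_all add: less_imp_le)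
  finally have "(fact k :: nat) \<le> 2 ^ (k * k)" by (simp add: power_mult)
  then show ?thesis by (metis of_nat_fact of_nat_le_iff of_nat_numeral of_nat_power)
qed

lemma perm_nonneg: "(\<And>u v. u < n \<Longrightarrow> v < n \<Longrightarrow> W u v \<ge> 0) \<Longrightarrow> perm n W \<ge> 0"
  unfolding perm_def by (intro sum_nonneg prod_nonneg) (auto dest: permutes_in_image)

section \<open>Growth of the least common multiple of \<open>1, \<dots>, n\<close>\<close>

definition lcm_upto :: "nat \<Rightarrow> nat" where "lcm_upto n = Lcm {1..n}"

lemma lcm_upto_0 [simp]: "lcm_upto 0 = 1"
  by (simp add: lcm_upto_def)

lemma lcm_upto_Suc: "lcm_upto (Suc n) = lcm (Suc n) (lcm_upto n)"
proof -
  have "{1..Suc n} = insert (Suc n) {1..n}" by auto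
  then show ?thesis by (simp add: lcm_upto_def)
qed

lemma lcm_upto_pos [simp]: "lcm_upto n > 0"
  by (induction n) (auto simp: lcm_upto_Suc lcm_pos_nat)

lemma lcm_upto_mono: "m \<le> n \<Longrightarrow> lcm_upto m \<le> lcm_upto n"
  by (rule dvd_imp_le[OF _ lcm_upto_pos]) (auto simp: lcm_upto_def intro!: Lcm_subset)

lemma dvd_lcm_upto: "0 < i \<Longrightarrow> i \<le> n \<Longrightarrow> i dvd lcm_upto n"
  unfolding lcm_upto_def by (rule dvd_Lcm) auto

lemma lcm_upto_le: "n \<ge> 1 \<Longrightarrow> lcm_upto n \<le> n ^ n"
proof (induction n)
  case (Suc n)
  have "lcm_upto (Suc n) \<le> Suc n * lcm_upto n" unfolding lcm_upto_Suc
    by (rule dvd_imp_le) (auto intro!: lcm_least simp del: mult_Suc)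
  also have "lcm_upto n \<le> Suc n ^ n"
  proof (cases "n = 0")
    case False
    then show ?thesis using Suc.IH power_mono[of n "Suc n" n] by (auto intro: le_trans)
  qed auto
  finally show ?case by (simp del: mult_Suc)
qed auto

text \<open>The reciprocals of \<open>m * (n choose m)\<close> form Leibniz' harmonic triangle, whose entries are differences of neighbours.\<close>

lemma binomial_dvd_lcm_upto:
  "1 \<le> m \<Longrightarrow> m \<le> n \<Longrightarrow> m * (n choose m) dvd lcm_upto n"
proof (induction n arbitrary: m)
  case (Suc n)
  note IHn = Suc.IH
  show ?case using Suc.prems(2,1)
  proof (induction m rule: inc_induct)
    case base
    then show ?case by (simp add: dvd_lcm_upto)
  next
    case (step m)
    let ?L = "lcm_upto (Suc n)"
    have m: "1 \<le> m" "m \<le> n" using step by auto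
    \<comment> \<open>The quotients \<open>p\<close> and \<open>r\<close> are \<open>?L\<close>
      times the reciprocals of two entries of the triangle, so their difference is the quotient for
      the third, \<open>m * (Suc n choose m)\<close>. The lines below verify this without fractions;
      \<open>r \<le> p\<close> makes the subtraction of naturals exact.\<close>
    have "m * (n choose m) dvd ?L"
      using IHn[OF m] by (auto simp: lcm_upto_Suc intro: dvd_trans)
    then obtain p where p: "?L = m * (n choose m) * p" by (elim dvdE)
    have "Suc m * (Suc n choose Suc m) dvd ?L" using step by auto
    then obtain r where r: "?L = Suc m * (Suc n choose Suc m) * r" by (elim dvdE)
    have r': "?L = Suc n * (n choose m) * r" using r by (simp only: Suc_times_binomial)
    define c where "c = (n choose m)"
    define N where "N = Suc n"
    define C where "C = (Suc n choose m)"
    have c0: "c > 0" using m by (simp add: c_def)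
    have "c * (m * p) = c * (N * r)"
      using p r' unfolding c_def[symmetric] N_def[symmetric] by (metis mult.assoc mult.commute)
    then have e: "m * p = N * r" using c0 by simp
    have "m * r \<le> m * p" unfolding e using m by (intro mult_le_mono1) (simp add: N_def)
    then have rp: "r \<le> p" using m by simp
    have 1: "(N - m) * C = N * c"
      using m binomial_absorb_comp[of "Suc n" m] by (simp add: N_def C_def c_def)
    have 2: "m * (p - r) = (N - m) * r" using e by (simp add: diff_mult_distrib2 diff_mult_distrib)
    have "(N - m) * (m * C * (p - r)) = ((N - m) * C) * (m * (p - r))" by (simp only: ac_simps)
    also have "\<dots> = (N - m) * (N * c * r)" unfolding 1 2 by (simp only: ac_simps)
    also have "N * c * r = ?L" unfolding c_def N_def by (rule r'[symmetric])
    finally have "?L = m * C * (p - r)" using m by (simp add: N_def)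
    then show ?case unfolding C_def by simp
  qed
qed simp

text \<open>The central binomial coefficient is at least \<open>4 ^ m / (2 * m)\<close>, and the
  divisor \<open>m * (2 * m choose m)\<close> regains the factor \<open>m\<close>.\<close>

lemma lcm_upto_ge: "m \<ge> 1 \<Longrightarrow> 2 ^ (2 * m - 1) \<le> lcm_upto (2 * m)"
proof -
  assume m: "m \<ge> 1"
  have "(4::real) ^ m / (2 * real m) \<le> real ((2 * m) choose m)"
    using central_binomial_lower_bound[of m] m by simp
  then have "(4::real) ^ m \<le> 2 * real m * real ((2 * m) choose m)"
    using m by (simp add: field_simps)
  then have "real (4 ^ m) \<le> real (2 * (m * ((2 * m) choose m)))" by simp
  then have "(4::nat) ^ m \<le> 2 * (m * ((2 * m) choose m))" by (simp only: of_nat_le_iff)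
  moreover have "(4::nat) ^ m = 2 * 2 ^ (2 * m - 1)"
    using m by (simp add: power_mult[of 2 2, simplified] flip: power_Suc)
  moreover have "m * ((2 * m) choose m) \<le> lcm_upto (2 * m)"
    by (rule dvd_imp_le) (use m binomial_dvd_lcm_upto[of m "2 * m"] in auto)
  ultimately show ?thesis by linarith
qed

section \<open>Step counting for bounded programs\<close>

text \<open>
  The judgement \<open>tri B P s n Q\<close> below counts elementary steps, while all registers and memory cells
  stay below \<open>2 ^ B\<close>; \<open>wt P B\<close> bounds the cost of a single step.
\<close>

definition bd :: "nat \<Rightarrow> state \<Rightarrow> bool" where
  "bd B s \<longleftrightarrow> (\<forall>r. \<bar>fst s r\<bar> < 2 ^ B) \<and> (\<forall>a. \<bar>snd s a\<bar> < 2 ^ B)"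

fun eb :: "expr \<Rightarrow> nat \<Rightarrow> nat" where
  "eb (Const k) B = len k"
| "eb (Reg r) B = B"
| "eb (Load a) B = B"
| "eb (Plus a b) B = eb a B + eb b B + 1"
| "eb (Minus a b) B = eb a B + eb b B + 1"
| "eb (Times a b) B = eb a B + eb b B + 1"
| "eb (Divide a b) B = eb a B + eb b B + 1"
| "eb (Modulo a b) B = eb a B + eb b B + 1"
| "eb (Less a b) B = eb a B + eb b B + 1"
| "eb (Equal a b) B = eb a B + eb b B + 1"

text \<open>Additions and comparisons are charged like multiplications, so that one estimate serves
  all binary operations.\<close>

fun ec :: "expr \<Rightarrow> nat \<Rightarrow> nat" where
  "ec (Const k) B = len k"
| "ec (Reg r) B = B + 1"
| "ec (Load a) B = ec a B + eb a B + B + 2"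
| "ec (Plus a b) B = ec a B + ec b B + (eb a B + 2) * (eb b B + 2)"
| "ec (Minus a b) B = ec a B + ec b B + (eb a B + 2) * (eb b B + 2)"
| "ec (Times a b) B = ec a B + ec b B + (eb a B + 2) * (eb b B + 2)"
| "ec (Divide a b) B = ec a B + ec b B + (eb a B + 2) * (eb b B + 2)"
| "ec (Modulo a b) B = ec a B + ec b B + (eb a B + 2) * (eb b B + 2)"
| "ec (Less a b) B = ec a B + ec b B + (eb a B + 2) * (eb b B + 2)"
| "ec (Equal a b) B = ec a B + ec b B + (eb a B + 2) * (eb b B + 2)"

lemma len_le_iff: "len x \<le> m + 1 \<longleftrightarrow> \<bar>x\<bar> < 2 ^ m"
  by (auto simp: len_def bitlen_le_iff_power nat_le_iff)

lemma abs_add_less: "\<bar>x\<bar> < 2 ^ m \<Longrightarrow> \<bar>y\<bar> < 2 ^ n \<Longrightarrow> \<bar>x\<bar> + \<bar>y :: int\<bar> < 2 ^ (m + n + 1)"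
proof -
  assume "\<bar>x\<bar> < 2 ^ m" "\<bar>y\<bar> < 2 ^ n"
  then have "\<bar>x\<bar> < 2 ^ (m + n)" "\<bar>y\<bar> < 2 ^ (m + n)"
    by (auto elim!: less_le_trans intro!: power_increasing)
  then show ?thesis by simp
qed

lemma abs_div_le: "\<bar>x div y\<bar> \<le> \<bar>x :: int\<bar>"
proof -
  have pos: "\<bar>x div y\<bar> \<le> \<bar>x\<bar>" if "y > 0" for x y :: int
    using that zdiv_mono2[of x 1 y] zdiv_mono2_neg[of x 1 y] pos_imp_zdiv_nonneg_iff[of y x]
      pos_imp_zdiv_neg_iff[of y x] by (cases "x < 0") auto
  show ?thesis using pos[of y x] pos[of "- y" "- x"] by (cases y "0 :: int" rule: linorder_cases) auto
qed

lemma eval_bound: "bd B s \<Longrightarrow> \<bar>eval s e\<bar> < 2 ^ eb e B"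
proof (induction e)
  case (Const k)
  have "len k \<le> len k + 1" by simp
  then show ?case by (simp only: len_le_iff) simp
next
  case (Plus a b)
  then show ?case using abs_add_less[of "eval s a" "eb a B" "eval s b" "eb b B"] by auto
next
  case (Minus a b)
  then show ?case using abs_add_less[of "eval s a" "eb a B" "eval s b" "eb b B"] by auto
next
  case (Times a b)
  then have "\<bar>eval s a\<bar> * \<bar>eval s b\<bar> < 2 ^ eb a B * 2 ^ eb b B"
    by (intro mult_strict_mono) auto
  also have "\<dots> \<le> 2 ^ (eb a B + eb b B + 1)" by (simp add: power_add)
  finally show ?case by (simp add: abs_mult)
next
  case (Divide a b)
  have "\<bar>eval s a div eval s b\<bar> \<le> \<bar>eval s a\<bar>" by (rule abs_div_le)
  then show ?case using Divide abs_add_less[of "eval s a" "eb a B" "eval s b" "eb b B"] by auto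
next
  case (Modulo a b)
  \<comment> \<open>Modulo zero the value is the dividend, otherwise it is smaller than the divisor;
    the sum covers both cases.\<close>
  have "\<bar>eval s a mod eval s b\<bar> \<le> \<bar>eval s a\<bar> + \<bar>eval s b\<bar>"
    by (cases "eval s b = 0") (simp, smt (verit) pos_mod_sign pos_mod_bound neg_mod_sign neg_mod_bound)
  then show ?case using Modulo abs_add_less[of "eval s a" "eb a B" "eval s b" "eb b B"] by auto
next
  case (Less a b)
  have "1 < (2::int) ^ Suc (eb a B + eb b B)" by (rule one_less_power) auto
  then show ?case by simp
next
  case (Equal a b)
  have "1 < (2::int) ^ Suc (eb a B + eb b B)" by (rule one_less_power) auto
  then show ?case by simp
qed (auto simp: bd_def)

lemma eval_len: "bd B s \<Longrightarrow> len (eval s e) \<le> eb e B + 1"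
  unfolding len_le_iff by (rule eval_bound)

lemma cost_bound_aux:
  fixes c1 c2 d1 d2 l1 l2 b1 b2 :: nat
  assumes "c1 \<le> d1" "c2 \<le> d2" "l1 \<le> b1 + 1" "l2 \<le> b2 + 1"
  shows "c1 + c2 + l1 * l2 \<le> d1 + d2 + (b1 + 2) * (b2 + 2)"
    "c1 + c2 + l1 + l2 \<le> d1 + d2 + (b1 + 2) * (b2 + 2)"
proof -
  have "l1 * l2 \<le> (b1 + 2) * (b2 + 2)" using assms by (intro mult_le_mono) auto
  then show "c1 + c2 + l1 * l2 \<le> d1 + d2 + (b1 + 2) * (b2 + 2)" using assms by simp
  show "c1 + c2 + l1 + l2 \<le> d1 + d2 + (b1 + 2) * (b2 + 2)" using assms by simp
qed

text \<open>Summing over the syntax tree makes the weight of a program dominate that of each part,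
  so step counts of parts can simply be added.\<close>

fun wt :: "prog \<Rightarrow> nat \<Rightarrow> nat" where
  "wt Skip B = 1"
| "wt (Assign r e) B = ec e B + eb e B + 1"
| "wt (Store a e) B = ec a B + ec e B + eb a B + eb e B + 2"
| "wt (Seq P Q) B = wt P B + wt Q B"
| "wt (Cond e P Q) B = ec e B + wt P B + wt Q B"
| "wt (While e P) B = ec e B + wt P B"

lemma eb_le_aux:
  assumes "\<exists>C. \<forall>B\<ge>1. f B \<le> C * B" "\<exists>C. \<forall>B\<ge>1. g B \<le> C * (B :: nat)"
  shows "\<exists>E. \<forall>B\<ge>1. f B + g B + 1 \<le> E * B"
proof -
  from assms obtain C D where CD: "\<forall>B\<ge>1. f B \<le> C * B" "\<forall>B\<ge>1. g B \<le> D * B" by blast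
  show ?thesis
  proof (intro exI[of _ "C + D + 1"] allI impI)
  fix B :: nat assume B: "B \<ge> 1"
  have "f B \<le> C * B" "g B \<le> D * B" using CD B by auto
  then show "f B + g B + 1 \<le> (C + D + 1) * B" using B by (simp add: algebra_simps)
  qed
qed

lemma cost_bound: "bd B s \<Longrightarrow> cost s e \<le> ec e B"
proof (induction e)
  case (Reg r)
  then show ?case using eval_len[of B s "Reg r"] by simp
next
  case (Load a)
  have "len (snd s (eval s a)) \<le> B + 1"
    unfolding len_le_iff using Load.prems by (simp add: bd_def)
  then show ?case using Load eval_len[of B s a] by simp
qed (simp, (unfold cost.simps ec.simps, rule cost_bound_aux; use eval_len in blast)+)

text \<open>Total correctness with a step count. The size bound is assumed and re-established inside
  the judgement, so that no loop invariant has to mention it.\<close>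

definition tri :: "nat \<Rightarrow> prog \<Rightarrow> state \<Rightarrow> nat \<Rightarrow> (state \<Rightarrow> bool) \<Rightarrow> bool" where
  "tri B P s n Q \<longleftrightarrow> (bd B s \<longrightarrow> (\<exists>t s'. exec P s t s' \<and> t \<le> n * wt P B \<and> bd B s' \<and> Q s'))"

section \<open>Proof rules for the step-counting judgement\<close>

lemma tri_conseq: "tri B P s n Q \<Longrightarrow> n \<le> n' \<Longrightarrow> (\<And>s'. Q s' \<Longrightarrow> Q' s') \<Longrightarrow> tri B P s n' Q'"
  unfolding tri_def by (meson le_trans mult_le_mono1)

lemma tri_le: "tri B P s n Q \<Longrightarrow> n \<le> n' \<Longrightarrow> tri B P s n' Q"
  by (rule tri_conseq)

lemma tri_post: "tri B P s n Q \<Longrightarrow> (\<And>s'. Q s' \<Longrightarrow> Q' s') \<Longrightarrow> tri B P s n Q'"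
  by (rule tri_conseq[OF _ le_refl])

text \<open>For moving a value about which only the general size bound is known, such as one just
  loaded from memory.\<close>

lemma tri_bd: "(bd B s \<Longrightarrow> tri B P s n Q) \<Longrightarrow> tri B P s n Q"
  unfolding tri_def by blast

lemma tri_skip: "Q s \<Longrightarrow> tri B Skip s 1 Q"
  unfolding tri_def using exec.Skip by fastforce

lemma tri_assign:
  assumes "\<bar>eval s e\<bar> < 2 ^ B" "Q ((fst s)(r := eval s e), snd s)"
  shows "tri B (Assign r e) s 1 Q"
  unfolding tri_def
proof
  assume b: "bd B s"
  show "\<exists>t s'. exec (Assign r e) s t s' \<and> t \<le> 1 * wt (Assign r e) B \<and> bd B s' \<and> Q s'"
    by (rule exI, rule exI, rule conjI[OF exec.Assign])
      (use cost_bound[OF b, of e] eval_len[OF b, of e] b assms in \<open>auto simp: bd_def\<close>)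
qed

lemma tri_store:
  assumes "\<bar>eval s e\<bar> < 2 ^ B" "Q (fst s, (snd s)(eval s a := eval s e))"
  shows "tri B (Store a e) s 1 Q"
  unfolding tri_def
proof
  assume b: "bd B s"
  show "\<exists>t s'. exec (Store a e) s t s' \<and> t \<le> 1 * wt (Store a e) B \<and> bd B s' \<and> Q s'"
    by (rule exI, rule exI, rule conjI[OF exec.Store])
      (use cost_bound[OF b, of e] eval_len[OF b, of e]
        cost_bound[OF b, of a] eval_len[OF b, of a] b assms in \<open>auto simp: bd_def\<close>)
qed

lemma tri_seq:
  assumes "tri B P s n (\<lambda>s'. tri B P' s' n' Q)"
  shows "tri B (Seq P P') s (n + n') Q"
  unfolding tri_def
proof
  assume "bd B s"
  with assms obtain t s' t' s'' where *: "exec P s t s'" "t \<le> n * wt P B" "exec P' s' t' s''"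
    "t' \<le> n' * wt P' B" "bd B s''" "Q s''" unfolding tri_def by blast
  have "t + t' \<le> (n + n') * wt (Seq P P') B" using *(2,4) by (simp add: algebra_simps)
  then show "\<exists>t s'. exec (Seq P P') s t s' \<and> t \<le> (n + n') * wt (Seq P P') B \<and> bd B s' \<and> Q s'"
    using exec.Seq[OF *(1,3)] *(5,6) by blast
qed

lemma tri_cond:
  assumes "eval s e \<noteq> 0 \<Longrightarrow> tri B P s n Q" "eval s e = 0 \<Longrightarrow> tri B P' s n Q"
  shows "tri B (Cond e P P') s (Suc n) Q"
  unfolding tri_def
proof
  assume b: "bd B s"
  let ?P = "if eval s e \<noteq> 0 then P else P'"
  have "tri B ?P s n Q" using assms by auto
  with b obtain t s' where *: "exec ?P s t s'" "t \<le> n * wt ?P B" "bd B s'" "Q s'"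
    unfolding tri_def by blast
  have e: "exec (Cond e P P') s (cost s e + t) s'"
    using *(1) exec.CondTrue[of s e P t s' P'] exec.CondFalse[of s e P' t s' P] by (auto split: if_splits)
  have "cost s e + t \<le> ec e B + n * wt ?P B" using *(2) cost_bound[OF b, of e] by simp
  also have "\<dots> \<le> Suc n * wt (Cond e P P') B" by (auto simp: algebra_simps)
  finally show "\<exists>t s'. exec (Cond e P P') s t s' \<and> t \<le> Suc n * wt (Cond e P P') B \<and> bd B s' \<and> Q s'"
    using e *(3,4) by blast
qed

text \<open>The exact number \<open>N\<close> of rounds is fixed in advance and indexes the
  invariant, also for searches, whose length is known in the proof though not to the program. Each
  test counts as one step.\<close>

lemma tri_while:
  assumes I: "I 0 s"
    and step: "\<And>i s. i < N \<Longrightarrow> I i s \<Longrightarrow> eval s e \<noteq> 0 \<and> tri B P s c (I (Suc i))"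
    and stop: "\<And>s. I N s \<Longrightarrow> eval s e = 0 \<and> Q s"
  shows "tri B (While e P) s (N * (c + 1) + 1) Q"
proof -
  have "tri B (While e P) s ((N - i) * (c + 1) + 1) Q" if "i \<le> N" "I i s" for i s
    using that
  proof (induction "N - i" arbitrary: i s)
    case 0
    then have "eval s e = 0" "Q s" using stop by auto
    then show ?case unfolding tri_def
      using exec.WhileFalse[of s e P] cost_bound[of B s e] 0
      by (intro impI exI[of _ "cost s e"] exI[of _ s]) auto
  next
    case (Suc d)
    show ?case unfolding tri_def
    proof
      assume b: "bd B s"
      have i: "i < N" using Suc by simp
      from step[OF i Suc.prems(2)] b obtain t s' where *: "eval s e \<noteq> 0" "exec P s t s'"
        "t \<le> c * wt P B" "bd B s'" "I (Suc i) s'" unfolding tri_def by blast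
      have "tri B (While e P) s' ((N - Suc i) * (c + 1) + 1) Q"
        using Suc.hyps(2) i *(5) by (intro Suc.hyps(1)) auto
      with *(4) obtain u s'' where **: "exec (While e P) s' u s''"
        "u \<le> ((N - Suc i) * (c + 1) + 1) * wt (While e P) B" "bd B s''" "Q s''"
        unfolding tri_def by blast
      have "cost s e + t + u \<le> (c + 1) * wt (While e P) B + ((N - Suc i) * (c + 1) + 1) * wt (While e P) B"
        using *(3) **(2) cost_bound[OF b, of e] by (simp add: algebra_simps)
      also have "\<dots> = ((N - i) * (c + 1) + 1) * wt (While e P) B"
      proof -
        have "N - i = Suc (N - Suc i)" using i by simp
        then show ?thesis by (simp add: algebra_simps)
      qed
      finally show "\<exists>t s'. exec (While e P) s t s' \<and> t \<le> ((N - i) * (c + 1) + 1) * wt (While e P) B \<and> bd B s' \<and> Q s'"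
        using exec.WhileTrue[OF *(1,2) **(1)] **(3,4) by blast
    qed
  qed
  from this[of 0 s] I show ?thesis by simp
qed

definition For :: "nat \<Rightarrow> expr \<Rightarrow> prog \<Rightarrow> prog" where
  "For r e P = Seq (Assign r (Const 0))
     (While (Less (Reg r) e) (Seq P (Assign r (Plus (Reg r) (Const 1)))))"

text \<open>The limit \<open>e\<close> is evaluated anew before each round, hence
  \<open>bnd\<close>. A round pays for the body, the increment and the test; the final
  \<open>2\<close> is for the initial assignment and the failing test.\<close>

lemma tri_for:
  assumes I: "I 0 ((fst s)(r := 0), snd s)"
    and step: "\<And>i s'. i < N \<Longrightarrow> I i s' \<Longrightarrow> fst s' r = int i \<Longrightarrow>
      tri B P s' c (\<lambda>s''. fst s'' r = int i \<and> I (Suc i) ((fst s'')(r := int i + 1), snd s''))"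
    and bnd: "\<And>i s'. i \<le> N \<Longrightarrow> I i s' \<Longrightarrow> fst s' r = int i \<Longrightarrow> eval s' e = int N"
    and N: "int N < 2 ^ B"
    and Q: "\<And>s'. I N s' \<Longrightarrow> fst s' r = int N \<Longrightarrow> Q s'"
  shows "tri B (For r e P) s (N * (c + 2) + 2) Q"
proof -
  let ?s = "((fst s)(r := 0), snd s)"
  let ?I = "\<lambda>i s'. I i s' \<and> fst s' r = int i \<and> i \<le> N"
  have "tri B (While (Less (Reg r) e) (Seq P (Assign r (Plus (Reg r) (Const 1))))) ?s (N * (c + 1 + 1) + 1) Q"
  proof (rule tri_while[of ?I])
    show "?I 0 ?s" using I by simp
  next
    fix i s' assume i: "i < N" "?I i s'"
    then have i1: "\<bar>int i + 1\<bar> < 2 ^ B" using N by linarith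
    have "tri B (Seq P (Assign r (Plus (Reg r) (Const 1)))) s' (c + 1) (?I (Suc i))"
    proof (rule tri_seq, rule tri_conseq[OF step[of i s']])
      fix s'' assume "fst s'' r = int i \<and> I (Suc i) ((fst s'')(r := int i + 1), snd s'')"
      then show "tri B (Assign r (Plus (Reg r) (Const 1))) s'' 1 (?I (Suc i))"
        using i i1 by (intro tri_assign) auto
    qed (use i in auto)
    then show "eval s' (Less (Reg r) e) \<noteq> 0 \<and>
        tri B (Seq P (Assign r (Plus (Reg r) (Const 1)))) s' (c + 1) (?I (Suc i))"
      using i bnd[of i s'] by auto
  next
    fix s' assume "?I N s'"
    then show "eval s' (Less (Reg r) e) = 0 \<and> Q s'" using bnd[of N s'] Q by auto
  qed
  then have "tri B (For r e P) s (1 + (N * (c + 1 + 1) + 1)) Q"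
    unfolding For_def by (intro tri_seq tri_assign) auto
  then show ?thesis by (simp add: algebra_simps)
qed

section \<open>The weight of a fixed program is quadratic in the word length\<close>

lemma eb_le: "\<exists>C. \<forall>B\<ge>1. eb e B \<le> C * B"
proof (induction e)
  case (Const k)
  show ?case by (rule exI[of _ "len k"]) auto
qed (rule exI[of _ 1], simp, rule exI[of _ 1], simp, (unfold eb.simps)?, (rule eb_le_aux; assumption)+)

lemma ec_le_aux:
  assumes "\<exists>C. \<forall>B\<ge>1. ec a B \<le> C * B\<^sup>2" "\<exists>C. \<forall>B\<ge>1. ec b B \<le> C * B\<^sup>2"
  shows "\<exists>E. \<forall>B\<ge>1. ec a B + ec b B + (eb a B + 2) * (eb b B + 2) \<le> E * B\<^sup>2"
proof -
  from assms obtain C D where CD: "\<forall>B\<ge>1. ec a B \<le> C * B\<^sup>2" "\<forall>B\<ge>1. ec b B \<le> D * B\<^sup>2" by blast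
  obtain F G where FG: "\<forall>B\<ge>1. eb a B \<le> F * B" "\<forall>B\<ge>1. eb b B \<le> G * B" using eb_le by metis
  show ?thesis
  proof (intro exI[of _ "C + D + (F + 2) * (G + 2)"] allI impI)
    fix B :: nat assume B: "B \<ge> 1"
    have "ec a B \<le> C * B\<^sup>2" "ec b B \<le> D * B\<^sup>2" "eb a B \<le> F * B" "eb b B \<le> G * B"
      using CD FG B by auto
    moreover have "(eb a B + 2) * (eb b B + 2) \<le> ((F + 2) * B) * ((G + 2) * B)"
      using B calculation(3,4) by (intro mult_le_mono) (auto simp: algebra_simps)
    ultimately show "ec a B + ec b B + (eb a B + 2) * (eb b B + 2) \<le>
        (C + D + (F + 2) * (G + 2)) * B\<^sup>2" by (simp add: algebra_simps power2_eq_square)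
  qed
qed

lemma ec_le: "\<exists>C. \<forall>B\<ge>1. ec e B \<le> C * B\<^sup>2"
proof (induction e)
  case (Const k)
  show ?case by (rule exI[of _ "len k"]) auto
next
  case (Reg r)
  show ?case
  proof (intro exI[of _ 2] allI impI)
    fix B :: nat assume "B \<ge> 1"
    then have "B \<le> B\<^sup>2" "1 \<le> B\<^sup>2" by (auto simp: power2_eq_square)
    then show "ec (Reg r) B \<le> 2 * B\<^sup>2" by simp
  qed
next
  case (Load a)
  then obtain C D where "\<forall>B\<ge>1. ec a B \<le> C * B\<^sup>2" "\<forall>B\<ge>1. eb a B \<le> D * B" using eb_le by blast
  then have "\<forall>B\<ge>1. ec (Load a) B \<le> (C + D + 3) * B\<^sup>2"
  proof (intro allI impI)
    fix B :: nat assume *: "\<forall>B\<ge>1. ec a B \<le> C * B\<^sup>2" "\<forall>B\<ge>1. eb a B \<le> D * B" and B: "B \<ge> 1"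
    have "ec a B \<le> C * B\<^sup>2" "eb a B \<le> D * B" using * B by auto
    moreover have "B \<le> B\<^sup>2" "1 \<le> B\<^sup>2" using B by (auto simp: power2_eq_square)
    moreover have "D * B \<le> D * B\<^sup>2" using B by (auto simp: power2_eq_square)
    ultimately show "ec (Load a) B \<le> (C + D + 3) * B\<^sup>2"
      unfolding ec.simps add_mult_distrib by linarith
  qed
  then show ?case by blast
qed ((unfold ec.simps)?, (rule ec_le_aux; assumption)+)

text \<open>The program depends only on the polynomial bounding the input, not on \<open>n\<close>;
  hence passing from steps to time costs a factor quadratic in \<open>B\<close>.\<close>

lemma wt_le: "\<exists>C. \<forall>B\<ge>1. wt P B \<le> C * B\<^sup>2"
proof (induction P)
  case Skip
  show ?case by (rule exI[of _ 1]) auto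
next
  case (Assign r e)
  \<comment> \<open>\<open>ec (Load e) B\<close> already contains
    \<open>ec e B + eb e B + 1\<close>, the weight of the assignment.\<close>
  obtain C where "\<forall>B\<ge>1. ec (Load e) B \<le> C * B\<^sup>2" using ec_le by blast
  then show ?case by (intro exI[of _ C] allI impI) (auto elim: order_trans[rotated])
next
  case (Store a e)
  obtain C D where "\<forall>B\<ge>1. ec (Load e) B \<le> C * B\<^sup>2" "\<forall>B\<ge>1. ec (Load a) B \<le> D * B\<^sup>2" using ec_le by metis
  then show ?case by (intro exI[of _ "C + D"]) (force simp: algebra_simps)
next
  case (Seq P Q)
  then obtain C D where "\<forall>B\<ge>1. wt P B \<le> C * B\<^sup>2" "\<forall>B\<ge>1. wt Q B \<le> D * B\<^sup>2" by blast
  then show ?case by (intro exI[of _ "C + D"]) (force simp: algebra_simps)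
next
  case (Cond e P Q)
  then obtain C D E where "\<forall>B\<ge>1. wt P B \<le> C * B\<^sup>2" "\<forall>B\<ge>1. wt Q B \<le> D * B\<^sup>2" "\<forall>B\<ge>1. ec e B \<le> E * B\<^sup>2"
    using ec_le by metis
  then show ?case by (intro exI[of _ "E + C + D"]) (force simp: algebra_simps)
next
  case (While e P)
  then obtain C E where "\<forall>B\<ge>1. wt P B \<le> C * B\<^sup>2" "\<forall>B\<ge>1. ec e B \<le> E * B\<^sup>2"
    using ec_le by metis
  then show ?case by (intro exI[of _ "E + C"]) (force simp: algebra_simps)
qed

section \<open>The elimination program\<close>

definition mat_at :: "int \<Rightarrow> nat \<Rightarrow> (nat \<Rightarrow> nat \<Rightarrow> int) \<Rightarrow> state \<Rightarrow> bool" where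
  "mat_at b N W s \<longleftrightarrow> (\<forall>a<N * N. snd s (b + int a) = W (a div N) (a mod N))"

lemma index_facts:
  assumes "u < N" "v < (N::nat)"
  shows "u * N + v < N * N" "(u * N + v) div N = u" "(u * N + v) mod N = v"
proof -
  have "u * N + v < Suc u * N" using assms by simp
  also have "\<dots> \<le> N * N" using assms by (intro mult_le_mono1) auto
  finally show "u * N + v < N * N" .
qed (use assms in auto)

lemma mat_atD: "mat_at b N W s \<Longrightarrow> u < N \<Longrightarrow> v < N \<Longrightarrow> snd s (b + (int u * int N + int v)) = W u v"
  using index_facts[of u N v] unfolding mat_at_def by (metis of_nat_add of_nat_mult)

text \<open>
  Register conventions. Register 4 holds \<open>Z\<close>, 9 the start of the working copy of the matrix, 10 its
  dimension \<open>N\<close>, 11 the size \<open>K\<close> at which elimination stops, 12 the start of the original, 13 the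
  modulus \<open>Z ^ Suc (N - K)\<close>, 50 the answer of the program that evaluates the remaining permanent.
  A subprogram only writes to registers with numbers above those of its callers, so that a frame
  condition is always of the form \<open>\<forall>r<l. fst s' r = fst s r\<close>.
\<close>

definition elim_cell :: prog where
  "elim_cell = Cond (Times (Less (Divide (Reg 40) (Reg 10)) (Reg 34)) (Less (Modulo (Reg 40) (Reg 10)) (Reg 34)))
     (Store (Plus (Reg 9) (Reg 40))
       (Modulo (Plus (Load (Plus (Reg 9) (Reg 40)))
          (Times (Reg 4) (Times
             (Load (Plus (Reg 9) (Plus (Times (Divide (Reg 40) (Reg 10)) (Reg 10)) (Reg 34))))
             (Load (Plus (Reg 9) (Plus (Times (Reg 34) (Reg 10)) (Modulo (Reg 40) (Reg 10))))))))
        (Reg 13)))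
     Skip"

definition elim_step :: prog where
  "elim_step = For 40 (Times (Reg 10) (Reg 10)) elim_cell"

text \<open>The update can be done in place: it reads from row \<open>j\<close> and column
  \<open>j\<close>, and writes only where both indices are below \<open>j\<close>.\<close>

lemma tri_elim_step:
  assumes r: "fst s 10 = int N" "fst s 34 = int j" "j < N" "fst s 9 = b" "fst s 13 = ZM" "fst s 4 = Z"
    and ZM: "0 < ZM" "ZM \<le> 2 ^ B" and N: "int (N * N) < 2 ^ B"
    and W: "mat_at b N W s"
  shows "tri B elim_step s (N * N * 4 + 2) (\<lambda>s'. (\<forall>r<40. fst s' r = fst s r) \<and>
     mat_at b N (\<lambda>u v. if u < j \<and> v < j then estep Z j W u v mod ZM else W u v) s' \<and>
     (\<forall>a. a < b \<or> b + int (N * N) \<le> a \<longrightarrow> snd s' a = snd s a))"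
proof -
  define W' where "W' = (\<lambda>u v. if u < j \<and> v < j then estep Z j W u v mod ZM else W u v)"
  define V where "V i a = (if a < i then W' (a div N) (a mod N) else W (a div N) (a mod N))" for i a :: nat
  let ?I = "\<lambda>i s'. (\<forall>r<40. fst s' r = fst s r) \<and> (\<forall>a<N * N. snd s' (b + int a) = V i a) \<and>
     (\<forall>a. a < b \<or> b + int (N * N) \<le> a \<longrightarrow> snd s' a = snd s a)"
  have "tri B elim_step s (N * N * (2 + 2) + 2) (\<lambda>s'. (\<forall>r<40. fst s' r = fst s r) \<and> mat_at b N W' s' \<and>
     (\<forall>a. a < b \<or> b + int (N * N) \<le> a \<longrightarrow> snd s' a = snd s a))"
    unfolding elim_step_def
  proof (rule tri_for[of ?I])
    show "?I 0 ((fst s)(40 := 0), snd s)" using W by (auto simp: mat_at_def V_def)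
  next
    fix i s' assume i: "i < N * N" and I: "?I i s'" and i40: "fst s' 40 = int i"
    define u v where "u = i div N" and "v = i mod N"
    have i': "int i < int N * int N" using i by (metis of_nat_less_iff of_nat_mult)
    have uv: "u < N" "v < N" "i = u * N + v"
      using i assms(3) by (auto simp: u_def v_def less_mult_imp_div_less)
    have [simp]: "fst s' 10 = int N" "fst s' 34 = int j" "fst s' 9 = b" "fst s' 13 = ZM" "fst s' 4 = Z"
      "fst s' 40 = int i"
      using I r i40 by auto
    have d: "int i div int N = int u" "int i mod int N = int v"
      by (simp_all add: u_def v_def zdiv_int zmod_int)
    have rd: "snd s' (b + (int u' * int N + int v')) = V i (u' * N + v')" if "u' < N" "v' < N" for u' v'
      using I index_facts[OF that] by (metis of_nat_add of_nat_mult)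
    have r1: "snd s' (b + int i) = W u v" using I i by (simp add: V_def u_def v_def)
    have r2: "snd s' (b + (int u * int N + int j)) = W u j"
      using rd[OF uv(1) assms(3)] index_facts[OF uv(1) assms(3)] by (simp add: V_def W'_def)
    have r3: "snd s' (b + (int j * int N + int v)) = W j v"
      using rd[OF assms(3) uv(2)] index_facts[OF assms(3) uv(2)] by (simp add: V_def W'_def)
    have V: "V (Suc i) a = (if a = i then W' u v else V i a)" for a
      by (auto simp: V_def u_def v_def)
    have bb: "\<bar>x mod ZM\<bar> < 2 ^ B" for x
      using ZM pos_mod_bound[of ZM x] pos_mod_sign[of ZM x] by linarith
    show "tri B elim_cell s' 2 (\<lambda>s''. fst s'' 40 = int i \<and> ?I (Suc i) ((fst s'')(40 := int i + 1), snd s''))"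
      unfolding Suc_1[symmetric] elim_cell_def
    proof (rule tri_cond, goal_cases)
      case 1
      then have lt: "u < j" "v < j" by (auto simp: d split: if_splits)
      show ?case unfolding One_nat_def[symmetric]
        by (rule tri_store) (use I i i' lt in \<open>auto simp: bb d r1 r2 r3 V W'_def estep_def\<close>)
    next
      case 2
      then have "\<not> (u < j \<and> v < j)" by (auto simp: d split: if_splits)
      then have "W' u v = V i i" by (auto simp: W'_def V_def u_def v_def)
      then show ?case unfolding One_nat_def[symmetric] using I by (intro tri_skip) (auto simp: V)
    qed
  next
    fix i s' assume "i \<le> N * N" "?I i s'" "fst s' 40 = int i"
    then show "eval s' (Times (Reg 10) (Reg 10)) = int (N * N)" using r by auto
  next
    fix s' assume I: "?I (N * N) s'" "fst s' 40 = int (N * N)"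
    then show "(\<forall>r<40. fst s' r = fst s r) \<and> mat_at b N W' s' \<and>
     (\<forall>a. a < b \<or> b + int (N * N) \<le> a \<longrightarrow> snd s' a = snd s a)" by (auto simp: mat_at_def V_def)
  qed (rule N)
  then show ?thesis by (simp add: W'_def)
qed

text \<open>Register 34 is the index being eliminated, from \<open>N - 1\<close> downwards; 30 holds
  the remaining bits of the subset, 31 the product of the factors \<open>1 + Z * W j j\<close>, and
  32 the sign.\<close>

definition elim_body :: prog where
  "elim_body = Seq (Assign 34 (Minus (Minus (Reg 10) (Const 1)) (Reg 33)))
     (Seq (Cond (Modulo (Reg 30) (Const 2))
       (Seq (Assign 31 (Modulo (Times (Reg 31) (Plus (Const 1) (Times (Reg 4)
            (Load (Plus (Reg 9) (Plus (Times (Reg 34) (Reg 10)) (Reg 34))))))) (Reg 13)))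
          elim_step)
       (Assign 32 (Minus (Const 0) (Reg 32))))
     (Assign 30 (Divide (Reg 30) (Const 2))))"

definition elim :: prog where
  "elim = Seq (Assign 30 (Reg 20)) (Seq (Assign 31 (Const 1)) (Seq (Assign 32 (Const 1))
     (For 33 (Minus (Reg 10) (Reg 11)) elim_body)))"

text \<open>
  The product of sign, accumulated factor and contribution of the current matrix is invariant
  modulo \<open>ZM\<close>.
\<close>

definition elim_inv ::
  "state \<Rightarrow> int \<Rightarrow> nat \<Rightarrow> nat \<Rightarrow> int \<Rightarrow> int \<Rightarrow> nat \<Rightarrow> (nat \<Rightarrow> nat \<Rightarrow> int) \<Rightarrow> nat \<Rightarrow> state \<Rightarrow> bool" where
  "elim_inv s b N K Z ZM T W d s' \<longleftrightarrow> (\<forall>r<30. fst s' r = fst s r) \<and>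
     (\<forall>a. a < b \<or> b + int (N * N) \<le> a \<longrightarrow> snd s' a = snd s a) \<and>
     (\<exists>W' t. mat_at b N W' s' \<and> (\<forall>u<N. \<forall>v<N. 0 \<le> W' u v \<and> W' u v < ZM) \<and>
       fst s' 30 = int t \<and> t \<le> T \<and> \<bar>fst s' 32\<bar> = 1 \<and> 0 \<le> fst s' 31 \<and> fst s' 31 < ZM \<and>
       [fst s' 32 * fst s' 31 * contrib Z K d t W' = contrib Z K (N - K) T W] (mod ZM))"

lemma elim_invI:
  assumes "\<And>r. r < 30 \<Longrightarrow> fst s' r = fst s r"
    and "\<And>a. a < b \<or> b + int (N * N) \<le> a \<Longrightarrow> snd s' a = snd s a"
    and "mat_at b N W' s'" "\<forall>u<N. \<forall>v<N. 0 \<le> W' u v \<and> W' u v < ZM"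
    and "fst s' 30 = int t" "t \<le> T" "\<bar>fst s' 32\<bar> = 1" "0 \<le> fst s' 31" "fst s' 31 < ZM"
    and "[fst s' 32 * fst s' 31 * contrib Z K d t W' = contrib Z K (N - K) T W] (mod ZM)"
  shows "elim_inv s b N K Z ZM T W d s'"
  using assms unfolding elim_inv_def by blast

lemma mat_at_cong: "snd s = snd s' \<Longrightarrow> mat_at b N W s \<Longrightarrow> mat_at b N W s'"
  by (simp add: mat_at_def)

lemma tri_elim_body:
  assumes r: "fst s 10 = int N" "fst s 9 = b" "fst s 13 = ZM" "fst s 4 = Z"
    and ZM: "1 < ZM" "ZM \<le> 2 ^ B" and N: "int (N * N) < 2 ^ B" and T: "int T < 2 ^ B"
    and i: "i < N - K" and i33: "fst s' 33 = int i" and inv: "elim_inv s b N K Z ZM T W (N - K - i) s'"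
  shows "tri B elim_body s' (4 * (N * N) + 6)
    (\<lambda>s''. fst s'' 33 = int i \<and> elim_inv s b N K Z ZM T W (N - K - Suc i) ((fst s'')(33 := int i + 1), snd s''))"
proof -
  define j where "j = N - 1 - i"
  define d where "d = N - K - Suc i"
  have j: "j < N" "K + d = j" "N - K - i = Suc d" "int N - 1 - int i = int j"
    using i by (auto simp: j_def d_def)
  from inv obtain W' t where fr: "\<And>r. r < 30 \<Longrightarrow> fst s' r = fst s r"
    and mem: "\<And>a. a < b \<or> b + int (N * N) \<le> a \<Longrightarrow> snd s' a = snd s a"
    and W': "mat_at b N W' s'" "\<And>u v. u < N \<Longrightarrow> v < N \<Longrightarrow> 0 \<le> W' u v \<and> W' u v < ZM"
    and t: "fst s' 30 = int t" "t \<le> T" and sg: "\<bar>fst s' 32\<bar> = 1" and q: "0 \<le> fst s' 31" "fst s' 31 < ZM"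
    and c: "[fst s' 32 * fst s' 31 * contrib Z K (Suc d) t W' = contrib Z K (N - K) T W] (mod ZM)"
    unfolding elim_inv_def j(3) by blast
  have [simp]: "fst s' 10 = int N" "fst s' 9 = b" "fst s' 13 = ZM" "fst s' 4 = Z" "fst s' 33 = int i" "fst s' 30 = int t"
    using fr r i33 t by auto
  have N1: "N \<le> N * N" by simp
  have bb: "\<bar>x mod ZM\<bar> < 2 ^ B" for x
    using ZM pos_mod_bound[of ZM x] pos_mod_sign[of ZM x] by linarith
  have jB: "\<bar>int j\<bar> < 2 ^ B" using j(1) N N1 by linarith
  have half: "int t div 2 = int (t div 2)" by (simp add: zdiv_int)
  have tB: "\<bar>int (t div 2)\<bar> < 2 ^ B" using t T by linarith
  have rd: "snd s' (b + (int j * int N + int j)) = W' j j"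
    using mat_atD[OF W'(1) j(1) j(1)] by simp
  let ?s1 = "((fst s')(34 := int j), snd s')"
  let ?Q = "\<lambda>s''. fst s'' 33 = int i \<and> elim_inv s b N K Z ZM T W d ((fst s'')(33 := int i + 1), snd s'')"
  have body: "tri B (Cond (Modulo (Reg 30) (Const 2))
       (Seq (Assign 31 (Modulo (Times (Reg 31) (Plus (Const 1) (Times (Reg 4)
            (Load (Plus (Reg 9) (Plus (Times (Reg 34) (Reg 10)) (Reg 34))))))) (Reg 13)))
          elim_step)
       (Assign 32 (Minus (Const 0) (Reg 32)))) ?s1 (Suc (N * N * 4 + 3))
     (\<lambda>s''. fst s'' 30 = int t \<and> ?Q ((fst s'')(30 := int (t div 2)), snd s''))"
  proof (rule tri_cond, goal_cases)
    case 1
    then have "int t mod 2 \<noteq> 0" by simp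
    then have odd: "odd t" by presburger
    define q' where "q' = (fst s' 31 * (1 + Z * W' j j)) mod ZM"
    let ?s2 = "((fst s')(34 := int j, 31 := q'), snd s')"
    define W2 where "W2 = (\<lambda>u v. if u < j \<and> v < j then estep Z j W' u v mod ZM else W' u v)"
    have W2: "\<forall>u<N. \<forall>v<N. 0 \<le> W2 u v \<and> W2 u v < ZM" using W'(2) ZM by (auto simp: W2_def)
    \<comment> \<open>\<open>contrib_cong\<close> compares only indices below
      \<open>K + d = j\<close>, and there \<open>W2\<close> is the updated matrix reduced modulo
      \<open>ZM\<close>.\<close>
    have "[fst s' 32 * q' * contrib Z K d (t div 2) W2
        = fst s' 32 * (fst s' 31 * (1 + Z * W' j j)) * contrib Z K d (t div 2) (estep Z j W')] (mod ZM)"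
      by (intro cong_mult contrib_cong) (auto simp: q'_def W2_def j(2) unique_euclidean_semiring_class.cong_def)
    also have "fst s' 32 * (fst s' 31 * (1 + Z * W' j j)) * contrib Z K d (t div 2) (estep Z j W') =
        fst s' 32 * fst s' 31 * contrib Z K (Suc d) t W'" using odd j(2) by (simp add: ac_simps)
    also note c
    finally have c': "[fst s' 32 * q' * contrib Z K d (t div 2) W2 = contrib Z K (N - K) T W] (mod ZM)" .
    have q': "0 \<le> q'" "q' < ZM" using ZM by (auto simp: q'_def)
    have es: "tri B elim_step ?s2 (N * N * 4 + 2) (\<lambda>s''. (\<forall>r<40. fst s'' r = fst ?s2 r) \<and>
       mat_at b N W2 s'' \<and> (\<forall>a. a < b \<or> b + int (N * N) \<le> a \<longrightarrow> snd s'' a = snd ?s2 a))"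
      unfolding W2_def using ZM N W'(1) j(1) by (intro tri_elim_step) (auto simp: mat_at_def)
    have n: "N * N * 4 + 3 = 1 + (N * N * 4 + 2)" by simp
    show ?case unfolding n
    proof (rule tri_seq[OF tri_assign], goal_cases)
      case 1
      show ?case by (simp add: bb)
    next
      case 2
      have e: "((fst ?s1)(31 := eval ?s1 (Modulo (Times (Reg 31) (Plus (Const 1) (Times (Reg 4)
            (Load (Plus (Reg 9) (Plus (Times (Reg 34) (Reg 10)) (Reg 34))))))) (Reg 13))), snd ?s1) = ?s2"
        by (simp add: rd q'_def)
      show ?case unfolding e
      proof (rule tri_post[OF es], goal_cases)
        case (1 s'')
        then have m2: "mat_at b N W2 s''" and fr'': "\<And>r. r < 40 \<Longrightarrow> fst s'' r = fst ?s2 r"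
          and mem'': "\<And>a. a < b \<or> b + int (N * N) \<le> a \<Longrightarrow> snd s'' a = snd s' a" by auto
        have "elim_inv s b N K Z ZM T W d ((fst s'')(30 := int (t div 2), 33 := int i + 1), snd s'')"
          by (rule elim_invI[OF _ _ mat_at_cong[OF _ m2] W2, of _ _ "t div 2"])
            (use c' q' fr mem sg t(2) fr'' mem'' in simp_all)
        then show ?case using fr'' by simp
      qed
    qed
  next
    case 2
    then have "int t mod 2 = 0" by simp
    then have even: "even t" by presburger
    have c': "[- fst s' 32 * fst s' 31 * contrib Z K d (t div 2) W' = contrib Z K (N - K) T W] (mod ZM)"
      using c even by simp
    have sB: "\<bar>- fst s' 32\<bar> < 2 ^ B" using sg ZM by linarith
    show ?case
    proof (rule tri_le[OF tri_assign], goal_cases)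
      case 2
      have "elim_inv s b N K Z ZM T W d ((fst s')(34 := int j, 32 := - fst s' 32, 30 := int (t div 2), 33 := int i + 1), snd s')"
        by (rule elim_invI[OF _ _ mat_at_cong[OF _ W'(1)], of _ _ _ "t div 2"])
          (use c' q fr mem sg t(2) W'(2) in simp_all)
      then show ?case by simp
    qed (use sB in auto)
  qed
  have "tri B elim_body s' (1 + (Suc (N * N * 4 + 3) + 1)) ?Q"
    unfolding elim_body_def
  proof (rule tri_seq[OF tri_assign], goal_cases)
    case 1
    show ?case using jB j(4) by simp
  next
    case 2
    have e: "((fst s')(34 := eval s' (Minus (Minus (Reg 10) (Const 1)) (Reg 33))), snd s') = ?s1"
      by (simp add: j(4))
    show ?case unfolding e
      by (rule tri_seq, rule tri_post[OF body], rule tri_assign) (use tB half in auto)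
  qed
  then show ?thesis unfolding d_def by (rule tri_le) simp
qed

lemma tri_elim:
  assumes r: "fst s 10 = int N" "fst s 11 = int K" "fst s 9 = b" "fst s 13 = ZM" "fst s 4 = Z" "fst s 20 = int T"
    and ZM: "1 < ZM" "ZM \<le> 2 ^ B" and N: "int (N * N) < 2 ^ B" and T: "int T < 2 ^ B" and K: "K \<le> N"
    and W: "mat_at b N W s" "\<forall>u<N. \<forall>v<N. 0 \<le> W u v \<and> W u v < ZM"
  shows "tri B elim s ((N - K) * (4 * (N * N) + 8) + 5) (elim_inv s b N K Z ZM T W 0)"
proof -
  let ?s = "((fst s)(30 := int T, 31 := 1, 32 := 1), snd s)"
  have B1: "\<bar>1::int\<bar> < 2 ^ B" using ZM by simp
  have N1: "N \<le> N * N" by simp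
  have "tri B (For 33 (Minus (Reg 10) (Reg 11)) elim_body) ?s ((N - K) * (4 * (N * N) + 6 + 2) + 2)
      (elim_inv s b N K Z ZM T W 0)"
  proof (rule tri_for[of "\<lambda>i. elim_inv s b N K Z ZM T W (N - K - i)"], goal_cases)
    case 1
    show ?case unfolding elim_inv_def using W ZM
      by (auto simp: mat_at_def intro!: exI[of _ W] exI[of _ T])
  next
    case (2 i s')
    then show ?case by (intro tri_elim_body[OF r(1,3,4,5) ZM N T]) auto
  next
    case (3 i s')
    then show ?case using r K by (auto simp: elim_inv_def of_nat_diff)
  next
    case 4
    show ?case using N N1 by linarith
  qed auto
  then have "tri B elim s (1 + (1 + (1 + ((N - K) * (4 * (N * N) + 6 + 2) + 2)))) (elim_inv s b N K Z ZM T W 0)"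
    unfolding elim_def using T B1 r by (intro tri_seq tri_assign) auto
  then show ?thesis by (rule tri_le) simp
qed

section \<open>Summation over all subsets\<close>

definition copy :: prog where
  "copy = For 35 (Times (Reg 10) (Reg 10))
     (Store (Plus (Reg 9) (Reg 35)) (Modulo (Load (Plus (Reg 12) (Reg 35))) (Reg 13)))"

lemma tri_copy:
  assumes r: "fst s 10 = int N" "fst s 9 = b" "fst s 12 = a0" "fst s 13 = ZM"
    and ZM: "1 < ZM" "ZM \<le> 2 ^ B" and N: "int (N * N) < 2 ^ B"
    and disj: "a0 + int (N * N) \<le> b \<or> b + int (N * N) \<le> a0" and W: "mat_at a0 N W s"
  shows "tri B copy s (N * N * 3 + 2) (\<lambda>s'. (\<forall>r<30. fst s' r = fst s r) \<and>
     mat_at b N (\<lambda>u v. W u v mod ZM) s' \<and>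
     (\<forall>a. a < b \<or> b + int (N * N) \<le> a \<longrightarrow> snd s' a = snd s a))"
proof -
  let ?I = "\<lambda>i s'. (\<forall>r<30. fst s' r = fst s r) \<and>
     (\<forall>a<i. snd s' (b + int a) = W (a div N) (a mod N) mod ZM) \<and>
     (\<forall>a. a < b \<or> b + int (N * N) \<le> a \<longrightarrow> snd s' a = snd s a)"
  have bb: "\<bar>x mod ZM\<bar> < 2 ^ B" for x
    using ZM pos_mod_bound[of ZM x] pos_mod_sign[of ZM x] by linarith
  have "tri B copy s (N * N * (1 + 2) + 2) (\<lambda>s'. (\<forall>r<30. fst s' r = fst s r) \<and>
     mat_at b N (\<lambda>u v. W u v mod ZM) s' \<and>
     (\<forall>a. a < b \<or> b + int (N * N) \<le> a \<longrightarrow> snd s' a = snd s a))"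
    unfolding copy_def
  proof (rule tri_for[of ?I], goal_cases)
    case (2 i s')
    then have [simp]: "fst s' 10 = int N" "fst s' 9 = b" "fst s' 12 = a0" "fst s' 13 = ZM" "fst s' 35 = int i"
      using r by auto
    have i: "int i < int (N * N)" using 2(1) by (simp only: of_nat_less_iff)
    have "snd s' (a0 + int i) = snd s (a0 + int i)" using 2(2) i disj by force
    then have "snd s' (a0 + int i) = W (i div N) (i mod N)" using W 2(1) by (simp add: mat_at_def)
    then show ?case by (intro tri_store) (use 2 i in \<open>auto simp: bb less_Suc_eq\<close>)
  next
    case (5 s')
    then show ?case by (auto simp: mat_at_def)
  qed (use r N in auto)
  then show ?thesis by (rule tri_le) simp
qed

text \<open>Elimination destroys its matrix, so every subset starts from a fresh copy. The parameter
  \<open>leaf\<close> lets the same code serve for the table and for the main sum.\<close>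

definition all_body :: "prog \<Rightarrow> prog" where
  "all_body leaf = Seq copy (Seq elim (Seq leaf
     (Assign 21 (Modulo (Plus (Reg 21) (Times (Times (Reg 32) (Reg 31)) (Reg 50))) (Reg 13)))))"

text \<open>Registers 14 and 15 become \<open>Z ^ (N - K)\<close> and \<open>2 ^ (N - K)\<close>, 21
  accumulates the sum modulo register 13, and 22 receives the permanent modulo
  \<open>Z\<close>.\<close>

definition all_subsets :: "prog \<Rightarrow> prog" where
  "all_subsets leaf = Seq (Assign 14 (Const 1)) (Seq (Assign 15 (Const 1))
     (Seq (For 20 (Minus (Reg 10) (Reg 11))
        (Seq (Assign 14 (Times (Reg 14) (Reg 4))) (Assign 15 (Plus (Reg 15) (Reg 15)))))
     (Seq (Assign 13 (Times (Reg 14) (Reg 4))) (Seq (Assign 21 (Const 0))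
     (Seq (For 20 (Reg 15) (all_body leaf)) (Assign 22 (Divide (Reg 21) (Reg 14))))))))"

text \<open>The hypothesis on \<open>leaf\<close> concerns states that agree with \<open>s\<close>
  outside the working copy, so a leaf may rely on a table stored elsewhere. It must in turn preserve
  the memory and the registers of the surrounding loops.\<close>

lemma tri_all_subsets:
  fixes s :: state and N K :: nat
  defines "ZM \<equiv> fst s 4 ^ Suc (N - K)"
  assumes r: "fst s 10 = int N" "fst s 11 = int K" "fst s 12 = a0" "fst s 9 = b" "fst s 4 = Z"
    and Z: "1 < Z" and ZM: "ZM < 2 ^ B" and N: "int (N * N) < 2 ^ B" and m: "2 ^ (N - K) < (2::int) ^ B" and K: "K \<le> N"
    and disj: "a0 + int (N * N) \<le> b \<or> b + int (N * N) \<le> a0" and W: "mat_at a0 N W s"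
    and leaf: "\<And>s' W'. (\<forall>r<13. fst s' r = fst s r) \<Longrightarrow>
      (\<forall>a. a < b \<or> b + int (N * N) \<le> a \<longrightarrow> snd s' a = snd s a) \<Longrightarrow> mat_at b N W' s' \<Longrightarrow>
      (\<forall>u<N. \<forall>v<N. 0 \<le> W' u v \<and> W' u v < ZM) \<Longrightarrow>
      tri B leaf s' c (\<lambda>s''. fst s'' 50 = perm K W' \<and> (\<forall>r<50. fst s'' r = fst s' r) \<and> snd s'' = snd s')"
  shows "tri B (all_subsets leaf) s
    (2 ^ (N - K) * (3 * (N * N) + (N - K) * (4 * (N * N) + 8) + c + 10) + 4 * (N - K) + 9)
    (\<lambda>s'. fst s' 22 = perm N W mod Z \<and> (\<forall>r<13. fst s' r = fst s r) \<and>
     (\<forall>a. a < b \<or> b + int (N * N) \<le> a \<longrightarrow> snd s' a = snd s a))"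
proof -
  define m where "m = N - K"
  let ?fr = "\<lambda>s'. (\<forall>r<13. fst s' r = fst s r) \<and> (\<forall>a. a < b \<or> b + int (N * N) \<le> a \<longrightarrow> snd s' a = snd s a)"
  define acc where "acc t = (\<Sum>t'<t. contrib Z K m t' W)" for t
  let ?I = "\<lambda>t s'. ?fr s' \<and> fst s' 13 = ZM \<and> fst s' 14 = Z ^ m \<and> fst s' 15 = 2 ^ m \<and> fst s' 21 = acc t mod ZM"
  have ZM': "ZM = Z ^ Suc m" by (simp add: ZM_def m_def r)
  have ZM1: "1 < ZM" unfolding ZM' using Z by (rule one_less_power) simp
  have bb: "\<bar>x mod ZM\<bar> < 2 ^ B" for x
    using ZM ZM1 pos_mod_bound[of ZM x] pos_mod_sign[of ZM x] by linarith
  have Zi: "Z ^ i < 2 ^ B" if "i \<le> m" for i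
  proof -
    have "Z ^ i \<le> Z ^ m" using that Z by (intro power_increasing) auto
    also have "\<dots> < Z * Z ^ m" using Z by simp
    finally show ?thesis using ZM ZM' by simp
  qed
  have Ti: "(2::int) ^ i < 2 ^ B" if "i \<le> m" for i
    using that m power_increasing[of i m "2::int"] unfolding m_def by linarith
  have mm: "m < 2 ^ m" by simp
  have mB: "int m < 2 ^ B" using mm m unfolding m_def[symmetric] by (metis less_trans of_nat_less_iff of_nat_numeral of_nat_power)
  have N1: "N \<le> N * N" by simp
  have body: "tri B (all_body leaf) s' (3 * (N * N) + 2 + (m * (4 * (N * N) + 8) + 5) + c + 1)
      (\<lambda>s''. fst s'' 20 = int t \<and> ?I (Suc t) ((fst s'')(20 := int t + 1), snd s''))"
    if t: "t < 2 ^ m" and I: "?I t s'" and t20: "fst s' 20 = int t" for t s'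
  proof -
    have r': "fst s' 10 = int N" "fst s' 11 = int K" "fst s' 12 = a0" "fst s' 9 = b" "fst s' 4 = Z" "fst s' 13 = ZM"
      using I r by auto
    have W': "mat_at a0 N W s'" unfolding mat_at_def
    proof (intro allI impI)
      fix a assume a: "a < N * N"
      then have "int a < int (N * N)" by (simp only: of_nat_less_iff)
      then have "snd s' (a0 + int a) = snd s (a0 + int a)" using I disj by force
      then show "snd s' (a0 + int a) = W (a div N) (a mod N)" using W a by (simp add: mat_at_def)
    qed
    let ?W = "\<lambda>u v. W u v mod ZM"
    have tB: "int t < 2 ^ B" using t m unfolding m_def[symmetric]
      by (metis less_trans of_nat_less_iff of_nat_numeral of_nat_power)
    have "tri B (all_body leaf) s' (N * N * 3 + 2 + (m * (4 * (N * N) + 8) + 5 + (c + 1)))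
      (\<lambda>s''. fst s'' 20 = int t \<and> ?I (Suc t) ((fst s'')(20 := int t + 1), snd s''))"
      unfolding all_body_def
    proof (rule tri_seq, rule tri_post[OF tri_copy[OF r'(1,4,3,6) ZM1 less_imp_le[OF ZM] N disj W']], rule tri_seq, goal_cases)
      case (1 s1)
      show ?case
      proof (rule tri_post[OF tri_elim[of s1 N K b ZM Z t B ?W, folded m_def]], goal_cases)
        case (14 s2)
        then obtain W2 t2 where fr2: "\<And>r. r < 30 \<Longrightarrow> fst s2 r = fst s1 r"
          and mem2: "\<And>a. a < b \<or> b + int (N * N) \<le> a \<Longrightarrow> snd s2 a = snd s1 a"
          and W2: "mat_at b N W2 s2" "\<forall>u<N. \<forall>v<N. 0 \<le> W2 u v \<and> W2 u v < ZM"
          and c2: "[fst s2 32 * fst s2 31 * perm K W2 = contrib Z K m t ?W] (mod ZM)"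
          unfolding elim_inv_def m_def by auto
        have fr: "\<And>r. r < 13 \<Longrightarrow> fst s2 r = fst s r" "\<And>r. r < 30 \<Longrightarrow> fst s2 r = fst s' r"
          using fr2 1 I by auto
        have mem: "\<And>a. a < b \<or> b + int (N * N) \<le> a \<Longrightarrow> snd s2 a = snd s a"
          using mem2 1 I by auto
        have "[contrib Z K m t ?W = contrib Z K m t W] (mod ZM)"
          by (rule contrib_cong) (auto simp: unique_euclidean_semiring_class.cong_def)
        with c2 have c3: "[fst s2 32 * fst s2 31 * perm K W2 = contrib Z K m t W] (mod ZM)"
          by (rule cong_trans)
        have l: "tri B leaf s2 c (\<lambda>s''. fst s'' 50 = perm K W2 \<and> (\<forall>r<50. fst s'' r = fst s2 r) \<and> snd s'' = snd s2)"
          by (rule leaf) (use fr mem W2 in auto)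
        show ?case
        proof (rule tri_seq, rule tri_post[OF l], rule tri_assign, goal_cases)
          case (1 s3)
          then show ?case using fr(2) I by (simp add: bb)
        next
          case (2 s3)
          have "[acc t mod ZM + fst s2 32 * fst s2 31 * perm K W2 = acc t + contrib Z K m t W] (mod ZM)"
            by (intro cong_add c3) (simp add: unique_euclidean_semiring_class.cong_def)
          then have a: "(acc t mod ZM + fst s2 32 * fst s2 31 * perm K W2) mod ZM = acc (Suc t) mod ZM"
            by (simp add: unique_euclidean_semiring_class.cong_def acc_def)
          show ?case using 2 fr mem I t20 a by auto
        qed
      qed (use 1 r' I t20 ZM1 ZM N tB K in \<open>auto simp: m_def\<close>)
    qed
    then show ?thesis by (rule tri_le) simp
  qed
  let ?J = "\<lambda>i s'. ?fr s' \<and> fst s' 14 = Z ^ i \<and> fst s' 15 = 2 ^ i"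
  have F1: "tri B (For 20 (Minus (Reg 10) (Reg 11))
        (Seq (Assign 14 (Times (Reg 14) (Reg 4))) (Assign 15 (Plus (Reg 15) (Reg 15))))) s'
        (m * (1 + 1 + 2) + 2) (?J m)" if "?J 0 s'" for s'
  proof (rule tri_for[of ?J], goal_cases)
    case 1
    then show ?case using that by auto
  next
    case (2 i s1)
    have B1: "\<bar>Z ^ i * Z\<bar> < 2 ^ B" "\<bar>(2::int) ^ i + 2 ^ i\<bar> < 2 ^ B" using 2(1) Zi[of "Suc i"] Ti[of "Suc i"] Z
      by (auto simp: mult.commute)
    show ?case by (intro tri_seq tri_assign) (use 2 r B1 in auto)
  next
    case (3 i s1)
    then show ?case using r K by (auto simp: m_def of_nat_diff)
  qed (use mB in auto)
  have F2: "tri B (For 20 (Reg 15) (all_body leaf)) s'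
      (2 ^ m * (3 * (N * N) + 2 + (m * (4 * (N * N) + 8) + 5) + c + 1 + 2) + 2) (?I (2 ^ m))" if "?I 0 s'" for s'
  proof (rule tri_for[of ?I], goal_cases)
    case 1
    then show ?case using that by auto
  next
    case (2 i s1)
    then show ?case by (intro body) auto
  qed (use m in \<open>auto simp: m_def\<close>)
  have B1: "\<bar>1::int\<bar> < 2 ^ B" using ZM ZM1 by simp
  have "tri B (all_subsets leaf) s (1 + (1 + (m * (1 + 1 + 2) + 2 + (1 + (1 +
      (2 ^ m * (3 * (N * N) + 2 + (m * (4 * (N * N) + 8) + 5) + c + 1 + 2) + 2 + 1))))))
    (\<lambda>s'. fst s' 22 = perm N W mod Z \<and> (\<forall>r<13. fst s' r = fst s r) \<and>
     (\<forall>a. a < b \<or> b + int (N * N) \<le> a \<longrightarrow> snd s' a = snd s a))"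
    unfolding all_subsets_def
  proof (rule tri_seq[OF tri_assign[OF _ tri_seq[OF tri_assign]]], goal_cases)
    case 3
    show ?case
    proof (rule tri_seq, rule tri_post[OF F1], goal_cases)
      case 1
      show ?case by simp
    next
      case s1: (2 s1)
      then have e1: "eval s1 (Times (Reg 14) (Reg 4)) = ZM" using r by (simp add: ZM')
      show ?case
      proof (rule tri_seq, rule tri_assign, goal_cases)
        case 1
        then show ?case unfolding e1 using ZM ZM1 by simp
      next
        case 2
        show ?case unfolding e1
        proof (rule tri_seq, rule tri_assign, goal_cases)
          case 2
          show ?case
          proof (rule tri_seq, rule tri_post[OF F2], goal_cases)
            case 1
            show ?case using s1 by (simp add: acc_def)
          next
            case (2 s2)
            have e2: "eval s2 (Divide (Reg 21) (Reg 14)) = perm N W mod Z"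
              using 2 sum_contrib_mod[where Z = Z and d = m and K = K and W = W] Z K by (simp add: acc_def ZM' m_def)
            have "Z * 1 \<le> Z * Z ^ m" using Z by (intro mult_left_mono one_le_power) auto
            moreover have "Z * Z ^ m < 2 ^ B" using ZM unfolding ZM' by simp
            moreover have "perm N W mod Z < Z" "0 \<le> perm N W mod Z" using Z by simp_all
            ultimately have "perm N W mod Z < 2 ^ B" "0 \<le> perm N W mod Z" by linarith+
            then show ?case by (intro tri_assign) (unfold e2, use 2 in auto)
          qed
        qed simp
      qed
    qed
  qed (use B1 in auto)
  then show ?thesis unfolding m_def[symmetric] by (rule tri_le) (simp add: algebra_simps)
qed

section \<open>Chinese remaindering with a table\<close>

lemma digit_code:
  fixes x :: int
  assumes "x > 0" "\<And>i. i < m \<Longrightarrow> 0 \<le> d i \<and> d i < x"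
  shows "a < m \<Longrightarrow> (\<Sum>i<m. d i * x ^ i) div x ^ a mod x = d a"
    and "0 \<le> (\<Sum>i<m. d i * x ^ i)" and "(\<Sum>i<m. d i * x ^ i) < x ^ m"
proof -
  have n: "0 \<le> (\<Sum>i<j. d i * x ^ i) \<and> (\<Sum>i<j. d i * x ^ i) < x ^ j" if "j \<le> m" for j
    using that
  proof (induction j)
    case (Suc j)
    have "d j * x ^ j \<le> (x - 1) * x ^ j"
      using assms(1) assms(2)[of j] Suc.prems by (intro mult_right_mono) auto
    moreover have "0 \<le> d j * x ^ j" using assms(1) assms(2)[of j] Suc.prems by auto
    ultimately show ?case using Suc by (simp add: algebra_simps)
  qed auto
  show "0 \<le> (\<Sum>i<m. d i * x ^ i)" "(\<Sum>i<m. d i * x ^ i) < x ^ m" using n[of m] by auto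
  assume a: "a < m"
  have "(\<Sum>i<m. d i * x ^ i) = (\<Sum>i<a. d i * x ^ i) + (\<Sum>i=a..<m. d i * x ^ i)"
    using a by (metis lessThan_atLeast0 less_imp_le_nat sum.atLeastLessThan_concat zero_le)
  also have "(\<Sum>i=a..<m. d i * x ^ i) = d a * x ^ a + (\<Sum>i=Suc a..<m. d i * x ^ i)"
    using a by (simp add: sum.atLeast_Suc_lessThan)
  also have "(\<Sum>i=Suc a..<m. d i * x ^ i) = (\<Sum>i=Suc a..<m. d i * x ^ (i - Suc a)) * x * x ^ a"
    unfolding sum_distrib_right
  proof (rule sum.cong[OF refl])
    fix i assume "i \<in> {Suc a..<m}"
    then have "x ^ i = x ^ ((i - Suc a) + Suc a)" by simp
    then show "d i * x ^ i = d i * x ^ (i - Suc a) * x * x ^ a" unfolding power_add by simp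
  qed
  finally have e: "(\<Sum>i<m. d i * x ^ i) =
      (\<Sum>i<a. d i * x ^ i) + (d a + (\<Sum>i=Suc a..<m. d i * x ^ (i - Suc a)) * x) * x ^ a"
    by (simp add: algebra_simps)
  have "(\<Sum>i<m. d i * x ^ i) div x ^ a = d a + (\<Sum>i=Suc a..<m. d i * x ^ (i - Suc a)) * x"
    unfolding e using n[of a] a assms(1) by simp
  then show "(\<Sum>i<m. d i * x ^ i) div x ^ a mod x = d a" using assms(2)[OF a] by simp
qed

text \<open>A hit before \<open>T\<close> would agree with \<open>V\<close> modulo \<open>q\<close>
  and modulo \<open>L\<close>, hence modulo their least common multiple, although both it and the
  value at \<open>T\<close> lie in the range of residues. So upward search in steps of
  \<open>L\<close> stops first at \<open>T\<close>, after fewer than \<open>q\<close>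
  rounds.\<close>

lemma crt_search:
  fixes V L q :: int
  assumes "L > 0" "q > 0"
  defines "T \<equiv> (V mod lcm q L) div L"
  shows "V mod L + L * T = V mod lcm q L" "0 \<le> T" "T < q"
    "0 \<le> i \<Longrightarrow> i < T \<Longrightarrow> (V mod L + L * i) mod q \<noteq> V mod q"
proof -
  have pos: "lcm q L > 0" using assms(1,2) by (simp add: lcm_pos_int)
  show e: "V mod L + L * T = V mod lcm q L"
    unfolding T_def by (metis add.commute dvd_lcm2 mod_mod_cancel mult_div_mod_eq)
  show "0 \<le> T" unfolding T_def using assms(1) pos by (simp add: pos_imp_zdiv_nonneg_iff)
  have "lcm q L dvd q * L" by simp
  then have "lcm q L \<le> q * L" using assms(1,2) by (intro zdvd_imp_le) auto
  then have "V mod lcm q L < q * L" using pos by (meson less_le_trans pos_mod_bound)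
  moreover have "L * T \<le> V mod lcm q L" unfolding e[symmetric] using assms(1) by simp
  ultimately have "L * T < L * q" by (simp add: mult.commute)
  then show "T < q" using assms(1) by simp
  assume i: "0 \<le> i" "i < T"
  show "(V mod L + L * i) mod q \<noteq> V mod q"
  proof
    assume a: "(V mod L + L * i) mod q = V mod q"
    have b: "(V mod L + L * i) mod L = V mod L" by simp
    have "q dvd (V mod L + L * i) - V" "L dvd (V mod L + L * i) - V"
      using a b by (simp_all only: mod_eq_dvd_iff)
    then have "lcm q L dvd (V mod L + L * i) - V" by (rule lcm_least)
    then have c: "(V mod L + L * i) mod lcm q L = V mod lcm q L" by (simp add: mod_eq_dvd_iff)
    have d: "V mod L + L * i < V mod L + L * T" using i assms(1) by simp
    have "V mod L + L * i < lcm q L" using d e pos by (metis order.strict_trans pos_mod_bound)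
    moreover have "0 \<le> V mod L + L * i" using i assms(1) by simp
    ultimately show False using c d e by (metis mod_pos_pos_trivial order_less_irrefl)
  qed
qed

text \<open>The first multiple of \<open>L\<close> divisible by \<open>q\<close> is the least common
  multiple. The search starts at \<open>L\<close> itself, hence the \<open>- 1\<close> in
  \<open>T\<close>.\<close>

lemma lcm_search:
  fixes L q :: int
  assumes "L > 0" "q > 0"
  defines "T \<equiv> lcm q L div L - 1"
  shows "L + L * T = lcm q L" "0 \<le> T" "T < q"
    "0 \<le> i \<Longrightarrow> i < T \<Longrightarrow> (L + L * i) mod q \<noteq> 0"
proof -
  have pos: "lcm q L > 0" using assms(1,2) by (simp add: lcm_pos_int)
  show e: "L + L * T = lcm q L" unfolding T_def by (simp add: algebra_simps)
  have le: "L \<le> lcm q L" using pos by (intro zdvd_imp_le) auto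
  show "0 \<le> T" using e le assms(1) by (metis add_le_cancel_left add_0_right mult_le_0_iff not_le zero_le_mult_iff less_le_not_le)
  have "lcm q L dvd q * L" by simp
  then have "lcm q L \<le> q * L" using assms(1,2) by (intro zdvd_imp_le) auto
  then have "L * (1 + T) \<le> L * q" using e by (simp add: algebra_simps)
  then show "T < q" using assms(1) by simp
  assume i: "0 \<le> i" "i < T"
  show "(L + L * i) mod q \<noteq> 0"
  proof
    assume a: "(L + L * i) mod q = 0"
    have "lcm q L dvd L + L * i" using a by (intro lcm_least) auto
    moreover have "0 < L + L * i" using i assms(1) by (simp add: add_pos_nonneg)
    ultimately have "lcm q L \<le> L + L * i" by (intro zdvd_imp_le) auto
    moreover have "L * i < L * T" using i assms(1) by simp
    ultimately show False using e by simp
  qed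
qed

text \<open>
  Chinese remaindering with the moduli \<open>1, \<dots>, X - 1\<close>, which need not be coprime: register 50 holds
  the permanent modulo the least common multiple (register 51) of the moduli treated so far.
  Permanents of matrices with entries below \<open>X\<close> are read from the table, which stores the
  matrix with base-\<open>X\<close> code \<open>i\<close> at address \<open>- 1 - i\<close>.
\<close>

definition code_cell :: prog where
  "code_cell = Seq (Assign 53 (Plus (Reg 53) (Times (Modulo (Load (Plus (Reg 9)
       (Plus (Times (Divide (Reg 54) (Reg 3)) (Reg 10)) (Modulo (Reg 54) (Reg 3))))) (Reg 57)) (Reg 55))))
     (Assign 55 (Times (Reg 55) (Reg 2)))"

lemma tri_code:
  fixes s :: state and K X :: nat and W :: "nat \<Rightarrow> nat \<Rightarrow> int" and q :: int
  defines "d \<equiv> \<lambda>a. W (a div K) (a mod K) mod q"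
  assumes r: "fst s 2 = int X" "fst s 3 = int K" "fst s 9 = b" "fst s 10 = int N" "fst s 57 = q"
      "fst s 53 = 0" "fst s 55 = 1"
    and K: "K \<le> N" and q: "0 < q" "q \<le> int X" and W: "mat_at b N W s"
    and XB: "int X ^ (K * K) < 2 ^ B" and KB: "int (K * K) < 2 ^ B"
  shows "tri B (For 54 (Times (Reg 3) (Reg 3)) code_cell) s (K * K * 4 + 2) (\<lambda>s'. 
     fst s' 53 = (\<Sum>a<K * K. d a * int X ^ a) \<and> (\<forall>r. r < 53 \<or> 56 \<le> r \<longrightarrow> fst s' r = fst s r) \<and> snd s' = snd s)"
proof -
  let ?I = "\<lambda>i s'. fst s' 53 = (\<Sum>a<i. d a * int X ^ a) \<and> fst s' 55 = int X ^ i \<and>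
     (\<forall>r. r < 53 \<or> 56 \<le> r \<longrightarrow> fst s' r = fst s r) \<and> snd s' = snd s"
  have X: "0 < int X" using q by simp
  have dd: "0 \<le> d a \<and> d a < int X" for a
    using q pos_mod_bound[OF q(1), of "W (a div K) (a mod K)"] pos_mod_sign[OF q(1), of "W (a div K) (a mod K)"]
    unfolding d_def by linarith
  have XB': "int X ^ i < 2 ^ B" if "i \<le> K * K" for i
    using XB power_increasing[OF that, of "int X"] X by linarith
  have cB: "\<bar>\<Sum>a<i. d a * int X ^ a\<bar> < 2 ^ B" if "i \<le> K * K" for i
    using XB'[OF that] digit_code(2,3)[OF X, of i d] dd by fastforce
  have "tri B (For 54 (Times (Reg 3) (Reg 3)) code_cell) s (K * K * (1 + 1 + 2) + 2) (\<lambda>s'. 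
     fst s' 53 = (\<Sum>a<K * K. d a * int X ^ a) \<and> (\<forall>r. r < 53 \<or> 56 \<le> r \<longrightarrow> fst s' r = fst s r) \<and> snd s' = snd s)"
  proof (rule tri_for[of ?I], goal_cases)
    case (2 i s')
    then have i: "i < K * K" by simp
    have [simp]: "fst s' 2 = int X" "fst s' 3 = int K" "fst s' 9 = b" "fst s' 10 = int N" "fst s' 57 = q"
      "fst s' 54 = int i" "fst s' 53 = (\<Sum>a<i. d a * int X ^ a)" "fst s' 55 = int X ^ i"
      using 2 r by auto
    have K0: "0 < K" using i by (cases K) auto
    have "i div K < K" "i mod K < K" using i K0 by (auto simp: less_mult_imp_div_less)
    then have uv: "i div K < N" "i mod K < N" using K by linarith+
    have ld: "snd s (b + (int i div int K * int N + int i mod int K)) = W (i div K) (i mod K)"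
      using mat_atD[OF W uv] by (simp add: zdiv_int zmod_int)
    have mem: "snd s' = snd s" using 2 by simp
    have di: "W (i div K) (i mod K) mod q = d i" by (simp add: d_def)
    show ?case unfolding code_cell_def
    proof (rule tri_seq[OF tri_assign[OF _ tri_assign]], goal_cases)
      case 1
      then show ?case using cB[of "Suc i"] i by (simp add: mem ld di)
    next
      case 2
      then show ?case using XB'[of "Suc i"] i by (simp add: mult.commute)
    next
      case 3
      then show ?case using \<open>?I i s' \<close> by (auto simp: ld di)
    qed
  qed (use r KB in auto)
  then show ?thesis by (rule tri_le) simp
qed

text \<open>One table serves all moduli, so it holds permanents of residue matrices that are not
  themselves reduced; this explains the reduction of register 58. The second loop turns register 51
  into the next least common multiple by repeatedly adding its old value, kept in 56.\<close>

definition crt_body :: prog where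
  "crt_body = Seq (Assign 57 (Plus (Reg 52) (Const 1))) (Seq (Assign 53 (Const 0)) (Seq (Assign 55 (Const 1))
     (Seq (For 54 (Times (Reg 3) (Reg 3)) code_cell)
     (Seq (Assign 58 (Load (Minus (Const (- 1)) (Reg 53))))
     (Seq (While (Minus (Modulo (Reg 50) (Reg 57)) (Modulo (Reg 58) (Reg 57))) (Assign 50 (Plus (Reg 50) (Reg 51))))
     (Seq (Assign 56 (Reg 51))
       (While (Modulo (Reg 51) (Reg 57)) (Assign 51 (Plus (Reg 51) (Reg 56))))))))))"

definition crt :: prog where
  "crt = Seq (Assign 50 (Const 0)) (Seq (Assign 51 (Const 1))
     (For 52 (Minus (Reg 2) (Const 1)) crt_body))"

definition table_at :: "nat \<Rightarrow> nat \<Rightarrow> nat \<Rightarrow> state \<Rightarrow> bool" where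
  "table_at c K X s \<longleftrightarrow> (\<forall>i<c. snd s (- 1 - int i) =
     perm K (\<lambda>u v. int i div int X ^ (u * K + v) mod int X))"

lemma tri_crt_body:
  assumes r: "fst s 2 = int X" "fst s 3 = int K" "fst s 9 = b" "fst s 10 = int N"
    and K: "K \<le> N" and W: "mat_at b N W s"
    and XB: "int X ^ (K * K) < 2 ^ B" and KB: "int (K * K) < 2 ^ B" and XB1: "int X < 2 ^ B"
    and T: "table_at (X ^ (K * K)) K X s"
    and LB: "int (lcm_upto (X - 1)) < 2 ^ B"
    and i: "i < X - 1" "fst s 52 = int i"
    and inv: "fst s 50 = V mod int (lcm_upto i)" "fst s 51 = int (lcm_upto i)" "V = perm K W"
  shows "tri B crt_body s (4 * (K * K) + 4 * X + 9) (\<lambda>s'. fst s' 50 = V mod int (lcm_upto (Suc i)) \<and>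
     fst s' 51 = int (lcm_upto (Suc i)) \<and> fst s' 52 = int i \<and> (\<forall>r<50. fst s' r = fst s r) \<and> snd s' = snd s)"
proof -
  define q where "q = int i + 1"
  define L where "L = int (lcm_upto i)"
  have q: "0 < q" "q \<le> int X" and L: "0 < L" using i by (auto simp: q_def L_def)
  have lcm: "int (lcm_upto (Suc i)) = lcm q L"
    by (simp add: lcm_upto_Suc q_def L_def add.commute flip: lcm_int_int_eq)
  have X: "0 < int X" using i by simp
  have "lcm_upto (Suc i) \<le> lcm_upto (X - 1)" using i by (intro lcm_upto_mono) simp
  then have lB: "lcm q L < 2 ^ B" using LB lcm by linarith
  have lpos: "0 < lcm q L" using lcm[symmetric] by simp
  have qB: "q < 2 ^ B" using q XB1 by linarith
  define d where "d = (\<lambda>a. W (a div K) (a mod K) mod q)"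
  define C where "C = (\<Sum>a<K * K. d a * int X ^ a)"
  have dd: "0 \<le> d a \<and> d a < int X" for a
    using q pos_mod_bound[OF q(1), of "W (a div K) (a mod K)"] pos_mod_sign[OF q(1), of "W (a div K) (a mod K)"]
    unfolding d_def by linarith
  have C: "0 \<le> C" "C < int X ^ (K * K)" "a < K * K \<Longrightarrow> C div int X ^ a mod int X = d a" for a
    unfolding C_def using digit_code[OF X, of "K * K" d] dd by auto
  define c where "c = nat C"
  have c: "int c = C" "c < X ^ (K * K)" using C by (auto simp: c_def nat_less_iff)
  define R where "R = snd s (- 1 - C)"
  have "R = perm K (\<lambda>u v. C div int X ^ (u * K + v) mod int X)"
    using T c unfolding table_at_def R_def by metis
  also have "\<dots> = perm K (\<lambda>u v. W u v mod q)"
    by (rule perm_eqI) (use C(3) index_facts in \<open>simp add: d_def\<close>)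
  also have "[\<dots> = perm K W] (mod q)" by (rule perm_cong) (simp add: unique_euclidean_semiring_class.cong_def)
  finally have "[R = perm K W] (mod q)" .
  then have RV: "R mod q = V mod q" by (simp add: unique_euclidean_semiring_class.cong_def inv)
  note cs = crt_search[OF L q(1), where V = V] and ls = lcm_search[OF L q(1)]
  define T1 where "T1 = nat ((V mod lcm q L) div L)"
  define T2 where "T2 = nat (lcm q L div L - 1)"
  have T1: "int T1 = (V mod lcm q L) div L" "T1 \<le> X" using cs(2,3) q by (auto simp: T1_def)
  have T2: "int T2 = lcm q L div L - 1" "T2 \<le> X" using ls(2,3) q by (auto simp: T2_def)
  \<comment> \<open>Both searches stay within \<open>lcm q L\<close>, which keeps their values
    inside the word length.\<close>
  have mB: "V mod L + L * int j < 2 ^ B" "0 \<le> V mod L + L * int j" if "j \<le> T1" for j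
  proof -
    have "V mod L + L * int j \<le> V mod L + L * int T1" using that L by simp
    also have "\<dots> < lcm q L" unfolding T1 cs(1) using lpos by simp
    finally show "V mod L + L * int j < 2 ^ B" using lB by simp
    show "0 \<le> V mod L + L * int j" using L by simp
  qed
  have mB2: "L + L * int j < 2 ^ B" "0 \<le> L + L * int j" if "j \<le> T2" for j
  proof -
    have "L + L * int j \<le> L + L * int T2" using that L by simp
    also have "\<dots> = lcm q L" unfolding T2 ls(1) by simp
    finally show "L + L * int j < 2 ^ B" using lB by simp
    show "0 \<le> L + L * int j" using L by simp
  qed
  let ?fr = "\<lambda>s'. (\<forall>r<50. fst s' r = fst s r) \<and> snd s' = snd s \<and> fst s' 52 = int i \<and> fst s' 57 = q"
  have W1: "tri B (While (Minus (Modulo (Reg 50) (Reg 57)) (Modulo (Reg 58) (Reg 57))) (Assign 50 (Plus (Reg 50) (Reg 51)))) s'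
      (T1 * (1 + 1) + 1) (\<lambda>s'. ?fr s' \<and> fst s' 50 = V mod lcm q L \<and> fst s' 51 = L)"
    if s': "?fr s'" "fst s' 50 = V mod L" "fst s' 51 = L" "fst s' 58 = R" for s'
  proof (rule tri_while[of "\<lambda>j s'. ?fr s' \<and> fst s' 50 = V mod L + L * int j \<and> fst s' 51 = L \<and> fst s' 58 = R"], goal_cases)
    case (2 j s1)
    have "(V mod L + L * int j) mod q \<noteq> V mod q" using 2(1) T1 by (intro cs(4)) auto
    moreover have "tri B (Assign 50 (Plus (Reg 50) (Reg 51))) s1 1
        (\<lambda>s'. ?fr s' \<and> fst s' 50 = V mod L + L * int (Suc j) \<and> fst s' 51 = L \<and> fst s' 58 = R)"
      using 2 mB[of "Suc j"] by (intro tri_assign) (auto simp: algebra_simps)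
    ultimately show ?case using 2 RV by auto
  next
    case (3 s1)
    have "(V mod lcm q L) mod q = V mod q" by (simp add: mod_mod_cancel)
    then show ?case using 3 RV T1(1) cs(1) by simp
  qed (use s' in auto)
  have W2: "tri B (While (Modulo (Reg 51) (Reg 57)) (Assign 51 (Plus (Reg 51) (Reg 56)))) s'
      (T2 * (1 + 1) + 1) (\<lambda>s'. ?fr s' \<and> fst s' 50 = V mod lcm q L \<and> fst s' 51 = lcm q L)"
    if s': "?fr s'" "fst s' 50 = V mod lcm q L" "fst s' 51 = L" "fst s' 56 = L" for s'
  proof (rule tri_while[of "\<lambda>j s'. ?fr s' \<and> fst s' 50 = V mod lcm q L \<and> fst s' 51 = L + L * int j \<and> fst s' 56 = L"], goal_cases)
    case (2 j s1)
    have "(L + L * int j) mod q \<noteq> 0" using 2(1) T2 by (intro ls(4)) auto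
    moreover have "tri B (Assign 51 (Plus (Reg 51) (Reg 56))) s1 1
        (\<lambda>s'. ?fr s' \<and> fst s' 50 = V mod lcm q L \<and> fst s' 51 = L + L * int (Suc j) \<and> fst s' 56 = L)"
      using 2 mB2[of "Suc j"] by (intro tri_assign) (auto simp: algebra_simps)
    ultimately show ?case using 2 by auto
  next
    case (3 s1)
    then show ?case using T2(1) ls(1) by simp
  qed (use s' in auto)
  have B1: "\<bar>1 :: int\<bar> < 2 ^ B" using q qB by simp
  have "tri B crt_body s (1 + (1 + (1 + (K * K * 4 + 2 + (1 + (T1 * (1 + 1) + 1 + (1 + (T2 * (1 + 1) + 1))))))))
    (\<lambda>s'. fst s' 50 = V mod int (lcm_upto (Suc i)) \<and>
     fst s' 51 = int (lcm_upto (Suc i)) \<and> fst s' 52 = int i \<and> (\<forall>r<50. fst s' r = fst s r) \<and> snd s' = snd s)"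
    unfolding crt_body_def lcm
  proof (rule tri_seq[OF tri_assign[OF _ tri_seq[OF tri_assign[OF _ tri_seq[OF tri_assign]]]]], goal_cases)
    case 4
    show ?case
    proof (rule tri_seq, rule tri_post[OF tri_code[where W = W and q = q, OF _ _ _ _ _ _ _ K q _ XB KB, folded d_def, folded C_def]], goal_cases)
      case (9 s1)
      then have e: "eval s1 (Load (Minus (Const (- 1)) (Reg 53))) = R" by (simp add: R_def C_def d_def)
      show ?case
      proof (rule tri_bd, rule tri_seq, rule tri_assign, goal_cases)
        case 1
        then show ?case by (simp add: bd_def)
      next
        case 2
        show ?case unfolding e
        proof (rule tri_seq, rule tri_post[OF W1], goal_cases)
          case (5 s2)
          then have "fst s2 51 = L" by simp
          then show ?case
            by (intro tri_seq[OF tri_assign[OF _ tri_post[OF W2]]]) (use 5 mB2[of 0] in auto)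
        qed (use 9 i inv in \<open>auto simp: q_def L_def\<close>)
      qed
    qed (use r W in \<open>auto simp: q_def i mat_at_def\<close>)
  qed (use B1 qB q i in \<open>auto simp: q_def\<close>)
  then show ?thesis by (rule tri_le) (use T1(2) T2(2) in simp)
qed

text \<open>The loop starts from the trivial residue \<open>0\<close> modulo
  \<open>lcm_upto 0 = 1\<close>. The last modulus is \<open>X - 1\<close>, and by \<open>V\<close>
  the permanent then equals its residue.\<close>

lemma tri_crt:
  assumes r: "fst s 2 = int X" "fst s 3 = int K" "fst s 9 = b" "fst s 10 = int N"
    and K: "K \<le> N" and W: "mat_at b N W s"
    and XB: "int X ^ (K * K) < 2 ^ B" and KB: "int (K * K) < 2 ^ B" and XB1: "int X < 2 ^ B" and X: "0 < X"
    and T: "table_at (X ^ (K * K)) K X s"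
    and LB: "int (lcm_upto (X - 1)) < 2 ^ B"
    and V: "0 \<le> perm K W" "perm K W < int (lcm_upto (X - 1))"
  shows "tri B crt s (X * (4 * (K * K) + 4 * X + 11) + 4)
     (\<lambda>s'. fst s' 50 = perm K W \<and> (\<forall>r<50. fst s' r = fst s r) \<and> snd s' = snd s)"
proof -
  let ?V = "perm K W"
  have B1: "\<bar>1::int\<bar> < 2 ^ B" using XB1 X by linarith
  let ?I = "\<lambda>i s'. fst s' 50 = ?V mod int (lcm_upto i) \<and>
     fst s' 51 = int (lcm_upto i) \<and> (\<forall>r<50. fst s' r = fst s r) \<and> snd s' = snd s"
  let ?s = "((fst s)(50 := 0, 51 := 1), snd s)"
  have "tri B (For 52 (Minus (Reg 2) (Const 1)) crt_body) ?s ((X - 1) * (4 * (K * K) + 4 * X + 9 + 2) + 2)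
     (\<lambda>s'. fst s' 50 = perm K W \<and> (\<forall>r<50. fst s' r = fst s r) \<and> snd s' = snd s)"
  proof (rule tri_for[of ?I], goal_cases)
    case (2 i s')
    have "mat_at b N W s'" using W 2 by (simp add: mat_at_def)
    moreover have "table_at (X ^ (K * K)) K X s'" using T 2 by (simp add: table_at_def)
    ultimately show ?case
      by (intro tri_post[OF tri_crt_body[of s' X K b N W B i ?V]]) (use r K XB KB XB1 LB 2 in auto)
  next
    case (5 s')
    then show ?case using V by auto
  next
    case 4
    then show ?case using XB1 by linarith
  qed (use r X in \<open>auto simp: of_nat_diff\<close>)
  then have "tri B crt s (1 + (1 + ((X - 1) * (4 * (K * K) + 4 * X + 9 + 2) + 2)))
     (\<lambda>s'. fst s' 50 = perm K W \<and> (\<forall>r<50. fst s' r = fst s r) \<and> snd s' = snd s)"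
    unfolding crt_def using B1 by (intro tri_seq[OF tri_assign[OF _ tri_seq[OF tri_assign]]]) auto
  moreover have "(X - 1) * (4 * (K * K) + 4 * X + 9 + 2) \<le> X * (4 * (K * K) + 4 * X + 11)"
    by (intro mult_le_mono) auto
  ultimately show ?thesis by (rule_tac tri_le) auto
qed

section \<open>Choice of the parameters\<close>

primrec pow_expr :: "expr \<Rightarrow> nat \<Rightarrow> expr" where
  "pow_expr e 0 = Const 1"
| "pow_expr e (Suc g) = Times e (pow_expr e g)"

lemma eval_pow_expr [simp]: "eval s (pow_expr e g) = eval s e ^ g"
  by (induction g) auto

text \<open>
  Matrix entries have at most \<open>(n + 2) ^ c\<close> bits. The size \<open>par_k\<close> of the tabulated matrices is
  chosen such that the table has \<open>par_X ^ (par_k * par_k) \<le> 2 ^ (n div 2)\<close> entries.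
\<close>

definition par_L :: "nat \<Rightarrow> nat" where
  "par_L n = (LEAST L. n + 2 < 2 ^ L)"

text \<open>The least common multiple of the numbers below \<open>X\<close> is at least
  \<open>2 ^ (X - 3)\<close>, while the permanents to be reconstructed have about
  \<open>(n + 2) ^ (c + 4)\<close> bits; the exponent \<open>c + 6\<close> leaves a margin. A power
  of two turns powers of \<open>X\<close> into plain exponents.\<close>

definition par_X :: "nat \<Rightarrow> nat \<Rightarrow> nat" where
  "par_X c n = 2 ^ (par_L n * (c + 6))"

text \<open>This is the largest \<open>k\<close> with
  \<open>2 * (c + 6) * par_L n * k\<^sup>2 \<le> n\<close>, in the form in which the loop of
  \<open>setup_prog\<close> finds it.\<close>

definition par_k :: "nat \<Rightarrow> nat \<Rightarrow> nat" where
  "par_k c n = (LEAST k. n < 2 * (c + 6) * par_L n * (k + 1)\<^sup>2)"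

text \<open>The exponent has room for \<open>fact n \<le> 2 ^ (n * n)\<close>, for \<open>n\<close>
  entries of \<open>(n + 2) ^ c\<close> bits and for a sign bit.\<close>

definition par_Z :: "nat \<Rightarrow> nat \<Rightarrow> int" where
  "par_Z c n = 2 ^ ((n + 2) ^ (c + 2))"

text \<open>The word length makes \<open>2 ^ par_B c n\<close> equal to \<open>X ^ X\<close> for
  \<open>X = par_X c n\<close>, an easy upper bound for the least common multiple.\<close>

definition par_B :: "nat \<Rightarrow> nat \<Rightarrow> nat" where
  "par_B c n = par_L n * (c + 6) * par_X c n"

lemma par_L_less: "n + 2 < 2 ^ par_L n"
  unfolding par_L_def by (rule LeastI) (rule less_exp)

lemma par_L_le: "i < par_L n \<Longrightarrow> 2 ^ i \<le> n + 2"
  unfolding par_L_def by (drule not_less_Least) simp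

lemma par_L_pos: "1 \<le> par_L n"
  using par_L_less[of n] by (cases "par_L n") auto

lemma par_L_bounds: "2 ^ par_L n \<le> 2 * (n + 2)" "par_L n \<le> n + 2"
proof -
  obtain l where l: "par_L n = Suc l" using par_L_pos[of n] by (cases "par_L n") auto
  have *: "2 ^ l \<le> n + 2" using par_L_le[of l n] l by simp
  then show "2 ^ par_L n \<le> 2 * (n + 2)" by (simp add: l)
  have "l < 2 ^ l" by simp
  then show "par_L n \<le> n + 2" using * l by linarith
qed

lemma par_k_less: "n < 2 * (c + 6) * par_L n * (par_k c n + 1)\<^sup>2"
  unfolding par_k_def
proof (rule LeastI)
  have "1 * (n + 1)\<^sup>2 \<le> 2 * (c + 6) * par_L n * (n + 1)\<^sup>2"
    using par_L_pos[of n] by (intro mult_le_mono1) simp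
  then show "n < 2 * (c + 6) * par_L n * (n + 1)\<^sup>2" by (simp add: power2_eq_square)
qed

lemma par_k_le: "i < par_k c n \<Longrightarrow> 2 * (c + 6) * par_L n * (i + 1)\<^sup>2 \<le> n"
  unfolding par_k_def by (drule not_less_Least) simp

lemma par_k_le': "2 * (c + 6) * par_L n * (par_k c n)\<^sup>2 \<le> n"
  using par_k_le[of "par_k c n - 1" c n] by (cases "par_k c n") auto

lemma par_k_bounds:
  "par_k c n * par_k c n \<le> n" "par_k c n \<le> n"
  "par_L n * (c + 6) * (par_k c n * par_k c n) + 2 * par_k c n \<le> n"
proof -
  let ?k = "par_k c n" let ?g = "par_L n * (c + 6)"
  have g: "6 \<le> ?g" using par_L_pos[of n] mult_le_mono[of 1 "par_L n" 6 "c + 6"] by simp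
  have *: "2 * (?g * (?k * ?k)) \<le> n" using par_k_le'[of c n] by (simp only: power2_eq_square ac_simps)
  have **: "6 * (?k * ?k) \<le> ?g * (?k * ?k)" using g by (rule mult_le_mono1)
  show "?k * ?k \<le> n" using * ** by linarith
  have "?k \<le> ?k * ?k" by simp
  then show "?k \<le> n" "?g * (?k * ?k) + 2 * ?k \<le> n" using * ** by linarith+
qed

lemma par_X_gt: "(n + 3) ^ (c + 6) \<le> par_X c n"
  using power_mono[of "n + 3" "2 ^ par_L n" "c + 6"] par_L_less[of n] by (simp add: par_X_def power_mult)

lemma par_X_gt': "(n + 2) ^ (c + 5) * 2 < par_X c n"
proof -
  have "(n + 2) ^ (c + 5) * 2 < (n + 3) ^ (c + 5) * (n + 3)"
    by (intro mult_less_le_imp_less power_strict_mono) auto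
  also have "\<dots> = (n + 3) ^ (c + 6)" by (simp add: eval_nat_numeral)
  finally show ?thesis using par_X_gt[of n c] by linarith
qed

lemma pow_less_par_X: "i \<le> c + 5 \<Longrightarrow> (n + 2) ^ i * 2 < par_X c n"
  using par_X_gt'[of n c] power_increasing[of i "c + 5" "n + 2"] by linarith

lemma par_X_le: "par_X c n \<le> (n + 2) ^ (2 * (c + 6))"
proof -
  have "par_X c n \<le> (2 * (n + 2)) ^ (c + 6)"
    unfolding par_X_def power_mult by (intro power_mono par_L_bounds) auto
  also have "\<dots> \<le> ((n + 2) * (n + 2)) ^ (c + 6)" by (intro power_mono mult_le_mono1) auto
  finally show ?thesis by (simp only: power_mult power2_eq_square)
qed

text \<open>Each table entry takes \<open>2 ^ k\<close> steps up to a polynomial factor. The half of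
  the exponent that the table size leaves free absorbs this, so building the table is no dearer than
  the main sum.\<close>

lemma par_X_pow: "int (par_X c n) ^ (par_k c n * par_k c n) * 2 ^ par_k c n \<le> 2 ^ (n - par_k c n)"
proof -
  have "int (par_X c n) ^ (par_k c n * par_k c n) * 2 ^ par_k c n =
      2 ^ (par_L n * (c + 6) * (par_k c n * par_k c n) + par_k c n)"
    by (simp add: par_X_def power_add power_mult)
  also have "\<dots> \<le> 2 ^ (n - par_k c n)"
    using par_k_bounds(3)[of n c] by (intro power_increasing) auto
  finally show ?thesis .
qed

lemma le_par_B: "par_X c n \<le> par_B c n" "1 \<le> par_B c n"
proof -
  have "1 * par_X c n \<le> par_B c n" unfolding par_B_def
    using par_L_pos[of n] by (intro mult_le_mono1) simp
  then show "par_X c n \<le> par_B c n" by simp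
  moreover have "1 \<le> par_X c n" by (simp add: par_X_def)
  ultimately show "1 \<le> par_B c n" by linarith
qed

lemma two_pow_less_B: "i < par_X c n \<Longrightarrow> (2::int) ^ i < 2 ^ par_B c n"
  using le_par_B(1)[of c n] by (intro power_strict_increasing) auto

lemma less_B: "i \<le> par_X c n \<Longrightarrow> int i < 2 ^ par_B c n"
proof -
  assume "i \<le> par_X c n"
  then have "i \<le> par_B c n" using le_par_B(1)[of c n] by linarith
  moreover have "int (par_B c n) < 2 ^ par_B c n" by (metis less_exp of_nat_less_iff of_nat_numeral of_nat_power)
  ultimately show ?thesis by linarith
qed

lemma par_L_less_X: "par_L n < par_X c n" "n < par_X c n" "n + 2 < par_X c n" "n * n < par_X c n"
proof -
  show *: "n + 2 < par_X c n" using pow_less_par_X[of 1 c n] by simp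
  then show "par_L n < par_X c n" "n < par_X c n" using par_L_bounds(2)[of n] by auto
  have "n * n \<le> (n + 2) ^ 2" by (simp add: power2_eq_square algebra_simps)
  then show "n * n < par_X c n" using pow_less_par_X[of 2 c n] by linarith
qed

lemma X_pow_B: "i \<le> par_k c n * par_k c n \<Longrightarrow> int (par_X c n) ^ i < 2 ^ par_B c n"
proof -
  assume "i \<le> par_k c n * par_k c n"
  then have "par_L n * (c + 6) * i \<le> par_L n * (c + 6) * (par_k c n * par_k c n)" by (rule mult_le_mono2)
  then have "par_L n * (c + 6) * i < par_X c n"
    using par_k_bounds(3)[of n c] par_L_less_X(2)[of n c] by linarith
  then have "(2::int) ^ (par_L n * (c + 6) * i) < 2 ^ par_B c n" by (rule two_pow_less_B)
  then show ?thesis by (simp add: par_X_def power_mult)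
qed

lemma Z_pow_B: "i \<le> n + 1 \<Longrightarrow> par_Z c n ^ i < 2 ^ par_B c n"
proof -
  assume "i \<le> n + 1"
  then have "(n + 2) ^ (c + 2) * i \<le> (n + 2) ^ (c + 2) * (n + 2)" by (intro mult_le_mono) auto
  also have "\<dots> = (n + 2) ^ (c + 3)" by (simp add: eval_nat_numeral)
  also have "\<dots> < par_X c n" using pow_less_par_X[of "c + 3" c n] by simp
  finally show ?thesis unfolding par_Z_def power_mult[symmetric] by (rule two_pow_less_B)
qed

lemma lcm_less_B: "int (lcm_upto (par_X c n - 1)) < 2 ^ par_B c n"
proof -
  let ?X = "par_X c n"
  have X: "2 \<le> ?X" using par_L_less_X(3)[of n c] by simp
  have "lcm_upto (?X - 1) \<le> (?X - 1) ^ (?X - 1)" using X by (intro lcm_upto_le) simp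
  also have "\<dots> < ?X ^ (?X - 1)" using X by (intro power_strict_mono) auto
  also have "\<dots> \<le> ?X ^ ?X" using X by (intro power_increasing) auto
  also have "\<dots> = 2 ^ par_B c n" by (simp add: par_X_def par_B_def power_mult)
  finally show ?thesis by (metis of_nat_less_iff of_nat_numeral of_nat_power)
qed

text \<open>Guarantees that remaindering determines the permanents left after elimination, whose
  entries are residues modulo \<open>par_Z c n ^ Suc (n - par_k c n)\<close>.\<close>

lemma lcm_greater:
  assumes "\<And>u v. u < par_k c n \<Longrightarrow> v < par_k c n \<Longrightarrow> 0 \<le> W u v \<and> W u v < par_Z c n ^ Suc (n - par_k c n)"
  shows "0 \<le> perm (par_k c n) W" "perm (par_k c n) W < int (lcm_upto (par_X c n - 1))"
proof -
  let ?k = "par_k c n" let ?X = "par_X c n" let ?h = "n + 2"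
  show "0 \<le> perm ?k W" using assms by (intro perm_nonneg) auto
  have "\<bar>perm ?k W\<bar> \<le> fact ?k * (par_Z c n ^ Suc (n - ?k)) ^ ?k"
    using assms by (intro perm_abs_le) (auto simp: less_imp_le)
  also have "\<dots> \<le> 2 ^ (?k * ?k) * (par_Z c n ^ Suc (n - ?k)) ^ ?k"
    using fact_le_two_pow by (intro mult_right_mono) (auto simp: par_Z_def)
  also have "\<dots> = 2 ^ (?k * ?k + ?h ^ (c + 2) * Suc (n - ?k) * ?k)"
    by (simp only: par_Z_def power_mult[symmetric] power_add)
  also have "\<dots> < 2 ^ (?X - 3)"
  proof (rule power_strict_increasing)
    have "?h ^ (c + 2) * Suc (n - ?k) * ?k \<le> ?h ^ (c + 2) * ?h * ?h"
      using par_k_bounds(2)[of c n] by (intro mult_le_mono) auto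
    also have "\<dots> = ?h ^ (c + 4)" by (simp add: eval_nat_numeral)
    finally have 1: "?h ^ (c + 2) * Suc (n - ?k) * ?k \<le> ?h ^ (c + 4)" .
    have "2 * ?h ^ (c + 4) \<le> ?h ^ (c + 5)" by (simp add: eval_nat_numeral)
    moreover have "?h ^ 1 \<le> ?h ^ (c + 4)" by (intro power_increasing) auto
    moreover have "(2::nat) ^ 4 \<le> ?h ^ (c + 4)"
    proof -
      have "(2::nat) ^ 4 \<le> 2 ^ (c + 4)" by (intro power_increasing) auto
      also have "\<dots> \<le> ?h ^ (c + 4)" by (intro power_mono) auto
      finally show ?thesis .
    qed
    moreover note pow_less_par_X[of "c + 5" c n] par_k_bounds(1)[of c n] 1
    ultimately show "?k * ?k + ?h ^ (c + 2) * Suc (n - ?k) * ?k < ?X - 3" by simp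
  qed simp
  finally have 1: "\<bar>perm ?k W\<bar> < 2 ^ (?X - 3)" .
  \<comment> \<open>\<open>lcm_upto_ge\<close> needs an even argument. As \<open>?X\<close> is even,
    \<open>2 * m = ?X - 2\<close> is the largest one below \<open>?X\<close>, and
    \<open>2 * m - 1 = ?X - 3\<close>.\<close>
  define m where "m = 2 ^ (par_L n * (c + 6) - 1) - (1::nat)"
  have e: "?X = 2 * (m + 1)"
  proof -
    have "par_L n * (c + 6) = Suc (par_L n * (c + 6) - 1)" using par_L_pos[of n] by simp
    then have "?X = 2 * 2 ^ (par_L n * (c + 6) - 1)" unfolding par_X_def by (metis power_Suc)
    then show ?thesis by (simp add: m_def)
  qed
  have m: "1 \<le> m" using e par_L_less_X(3)[of n c] by simp
  have "2 ^ (?X - 3) \<le> lcm_upto (2 * m)" using lcm_upto_ge[OF m] by (simp add: e numeral_3_eq_3)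
  also have "\<dots> \<le> lcm_upto (?X - 1)" by (intro lcm_upto_mono) (simp add: e)
  finally have "(2::int) ^ (?X - 3) \<le> int (lcm_upto (?X - 1))" by (metis of_nat_le_iff of_nat_numeral of_nat_power)
  then show "perm ?k W < int (lcm_upto (?X - 1))" using 1 by linarith
qed

text \<open>The table is computed with the same \<open>Z\<close> as the main sum; its permanents are
  nonnegative, so their residues need no correction of sign.\<close>

lemma small_perm:
  assumes "\<And>u v. u < par_k c n \<Longrightarrow> v < par_k c n \<Longrightarrow> 0 \<le> W u v \<and> W u v < int (par_X c n)"
  shows "perm (par_k c n) W mod par_Z c n = perm (par_k c n) W"
proof -
  let ?k = "par_k c n" let ?X = "par_X c n" let ?h = "n + 2"
  have "0 \<le> perm ?k W" using assms by (intro perm_nonneg) auto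
  have "\<bar>perm ?k W\<bar> \<le> fact ?k * int ?X ^ ?k"
    using assms by (intro perm_abs_le) (auto simp: less_imp_le)
  also have "\<dots> \<le> 2 ^ (?k * ?k) * int ?X ^ ?k"
    using fact_le_two_pow by (intro mult_right_mono) auto
  also have "\<dots> = 2 ^ (?k * ?k + par_L n * (c + 6) * ?k)"
    by (simp add: par_X_def power_add power_mult)
  also have "\<dots> < 2 ^ (?h ^ (c + 2))"
  proof (rule power_strict_increasing)
    have "par_L n * (c + 6) * ?k \<le> par_L n * (c + 6) * (?k * ?k)" by (intro mult_le_mono2) simp
    then have "?k * ?k + par_L n * (c + 6) * ?k \<le> 2 * n"
      using par_k_bounds(1)[of c n] par_k_bounds(3)[of n c] by linarith
    also have "\<dots> < ?h ^ 2" by (simp add: power2_eq_square algebra_simps)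
    also have "\<dots> \<le> ?h ^ (c + 2)" by (intro power_increasing) auto
    finally show "?k * ?k + par_L n * (c + 6) * ?k < ?h ^ (c + 2)" .
  qed simp
  finally show ?thesis using \<open>0 \<le> perm ?k W\<close> by (simp add: par_Z_def)
qed

lemma full_perm:
  assumes "\<And>u v. u < n \<Longrightarrow> v < n \<Longrightarrow> \<bar>W u v\<bar> \<le> 2 ^ ((n + 2) ^ c)"
  shows "2 * \<bar>perm n W\<bar> < par_Z c n"
proof -
  let ?h = "n + 2"
  have "\<bar>perm n W\<bar> \<le> fact n * (2 ^ (?h ^ c)) ^ n"
    using assms by (intro perm_abs_le) auto
  also have "\<dots> \<le> 2 ^ (n * n) * (2 ^ (?h ^ c)) ^ n"
    using fact_le_two_pow by (intro mult_right_mono) auto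
  finally have "2 * \<bar>perm n W\<bar> \<le> 2 ^ (1 + n * n + ?h ^ c * n)"
    by (simp add: power_add power_mult)
  also have "\<dots> < 2 ^ (?h ^ (c + 2))"
  proof (rule power_strict_increasing)
    have "1 \<le> ?h ^ c" by simp
    then have "n * n \<le> ?h ^ c * (n * n)" by simp
    moreover have "?h ^ (c + 2) = ?h ^ c * (n * n) + 4 * (?h ^ c * n) + 4 * ?h ^ c"
      by (simp add: power_add power2_eq_square algebra_simps)
    ultimately show "1 + n * n + ?h ^ c * n < ?h ^ (c + 2)" using \<open>1 \<le> ?h ^ c\<close> by linarith
  qed simp
  finally show ?thesis by (simp add: par_Z_def)
qed

section \<open>The algorithm\<close>

text \<open>Logarithm and square root are found by counting: registers 7 and 3 rise from the zeros
  of the input state to \<open>par_L n\<close> and \<open>par_k c n\<close>. Repeated doubling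
  yields \<open>Z\<close>, which has only polynomially many bits. Register 9 puts the working copy
  directly behind the input.\<close>

definition setup_prog :: "nat \<Rightarrow> prog" where
  "setup_prog c =
    Seq (Assign 1 (Plus (Reg 0) (Const 2)))
    (Seq (Assign 8 (Const 1))
    (Seq (While (Less (Reg 8) (Plus (Reg 1) (Const 1)))
       (Seq (Assign 8 (Plus (Reg 8) (Reg 8))) (Assign 7 (Plus (Reg 7) (Const 1)))))
    (Seq (Assign 2 (pow_expr (Reg 8) (c + 6)))
    (Seq (While (Less (Times (Const (2 * (int c + 6))) (Times (Reg 7)
         (Times (Plus (Reg 3) (Const 1)) (Plus (Reg 3) (Const 1))))) (Plus (Reg 0) (Const 1)))
       (Assign 3 (Plus (Reg 3) (Const 1))))
    (Seq (Assign 6 (Const 1))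
    (Seq (For 10 (Times (Reg 3) (Reg 3)) (Assign 6 (Times (Reg 6) (Reg 2))))
    (Seq (Assign 4 (Const 1))
    (Seq (For 10 (pow_expr (Reg 1) (c + 2)) (Assign 4 (Plus (Reg 4) (Reg 4))))
    (Assign 9 (Times (Reg 0) (Reg 0)))))))))))"

definition ready :: "nat \<Rightarrow> nat \<Rightarrow> state \<Rightarrow> bool" where
  "ready c n s \<longleftrightarrow> fst s 0 = int n \<and> fst s 2 = int (par_X c n) \<and> fst s 3 = int (par_k c n) \<and>
     fst s 4 = par_Z c n \<and> fst s 6 = int (par_X c n) ^ (par_k c n * par_k c n) \<and> fst s 9 = int (n * n)"

lemma tri_setup:
  assumes s: "fst s 0 = int n" "fst s 3 = 0" "fst s 7 = 0"
  shows "tri (par_B c n) (setup_prog c) s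
    (par_L n * 3 + par_k c n * 2 + par_k c n * par_k c n * 3 + (n + 2) ^ (c + 2) * 3 + 12)
    (\<lambda>s'. ready c n s' \<and> snd s' = snd s)"
proof -
  let ?B = "par_B c n" let ?L = "par_L n" let ?X = "par_X c n" let ?k = "par_k c n" let ?h = "n + 2"
  have B1: "\<bar>1::int\<bar> < 2 ^ ?B" "\<bar>0::int\<bar> < 2 ^ ?B" using le_par_B(2)[of c n] by auto
  have hB: "\<bar>int n + 2\<bar> < 2 ^ ?B" using less_B[of ?h c n] par_L_less_X(3)[of n c] by simp
  let ?I1 = "\<lambda>i s'. fst s' 0 = int n \<and> fst s' 1 = int ?h \<and> fst s' 3 = 0 \<and> fst s' 7 = int i \<and>
    fst s' 8 = 2 ^ i \<and> snd s' = snd s"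
  have w1: "tri ?B (While (Less (Reg 8) (Plus (Reg 1) (Const 1)))
       (Seq (Assign 8 (Plus (Reg 8) (Reg 8))) (Assign 7 (Plus (Reg 7) (Const 1))))) s'
       (?L * (1 + 1 + 1) + 1) (?I1 ?L)" if "?I1 0 s'" for s'
  proof (rule tri_while[of ?I1], goal_cases)
    case (2 i s1)
    have "2 ^ i \<le> n + 2" using 2(1) by (rule par_L_le)
    then have e: "(2::int) ^ i \<le> int n + 2" by (metis of_nat_add of_nat_le_iff of_nat_numeral of_nat_power)
    have "Suc i < ?X" using 2(1) par_L_less_X(1)[of n c] by simp
    note B = two_pow_less_B[OF this] less_B[OF less_imp_le[OF this]]
    have "tri ?B (Seq (Assign 8 (Plus (Reg 8) (Reg 8))) (Assign 7 (Plus (Reg 7) (Const 1)))) s1 (1 + 1) (?I1 (Suc i))"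
      by (rule tri_seq[OF tri_assign[OF _ tri_assign]]) (use 2 B in auto)
    then show ?case using 2 e by simp
  next
    case (3 s1)
    have "int (n + 2) < int (2 ^ ?L)" using par_L_less[of n] by (simp only: of_nat_less_iff)
    then show ?case using 3 by simp
  qed (use that in auto)
  have XX: "(2 ^ ?L) ^ (c + 6) = int ?X" by (simp add: par_X_def power_mult)
  have XB: "int ?X < 2 ^ ?B" by (rule less_B) simp
  let ?I2 = "\<lambda>i s'. fst s' 0 = int n \<and> fst s' 1 = int ?h \<and> fst s' 3 = int i \<and> fst s' 7 = int ?L \<and>
    fst s' 2 = int ?X \<and> snd s' = snd s"
  have cond: "int (2 * (c + 6) * ?L * (i + 1)\<^sup>2) = 2 * (int c + 6) * (int ?L * ((int i + 1) * (int i + 1)))" for i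
    by (simp add: power2_eq_square algebra_simps)
  have w2: "tri ?B (While (Less (Times (Const (2 * (int c + 6))) (Times (Reg 7)
         (Times (Plus (Reg 3) (Const 1)) (Plus (Reg 3) (Const 1))))) (Plus (Reg 0) (Const 1)))
       (Assign 3 (Plus (Reg 3) (Const 1)))) s' (?k * (1 + 1) + 1) (?I2 ?k)" if "?I2 0 s'" for s'
  proof (rule tri_while[of ?I2], goal_cases)
    case (2 i s1)
    have "2 * (c + 6) * ?L * (i + 1)\<^sup>2 \<le> n" using 2(1) by (rule par_k_le)
    then have e: "2 * (int c + 6) * (int ?L * ((int i + 1) * (int i + 1))) \<le> int n"
      unfolding cond[symmetric] by (simp only: of_nat_le_iff)
    have "int (Suc i) < 2 ^ ?B"
      using 2(1) par_k_bounds(2)[of c n] par_L_less_X(2)[of n c] by (intro less_B) linarith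
    then have "tri ?B (Assign 3 (Plus (Reg 3) (Const 1))) s1 1 (?I2 (Suc i))"
      by (intro tri_assign) (use 2 in auto)
    then show ?case using 2 e by simp
  next
    case (3 s1)
    have "int n < int (2 * (c + 6) * ?L * (?k + 1)\<^sup>2)" using par_k_less[of n c] by (simp only: of_nat_less_iff)
    then show ?case using 3 unfolding cond by simp
  qed (use that in auto)
  have n: "par_L n * 3 + par_k c n * 2 + par_k c n * par_k c n * 3 + (n + 2) ^ (c + 2) * 3 + 12 =
    1 + (1 + (?L * (1 + 1 + 1) + 1 + (1 + (?k * (1 + 1) + 1 + (1 + (?k * ?k * (1 + 2) + 2 + (1 + (?h ^ (c + 2) * (1 + 2) + 2 + 1))))))))"
    by simp
  let ?I3 = "\<lambda>i s'. fst s' 0 = int n \<and> fst s' 1 = int ?h \<and> fst s' 3 = int ?k \<and>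
    fst s' 2 = int ?X \<and> fst s' 6 = int ?X ^ i \<and> snd s' = snd s"
  have w3: "tri ?B (For 10 (Times (Reg 3) (Reg 3)) (Assign 6 (Times (Reg 6) (Reg 2)))) s'
     (?k * ?k * (1 + 2) + 2) (?I3 (?k * ?k))" if "?I3 0 s'" for s'
  proof (rule tri_for[of ?I3], goal_cases)
    case (2 i s1)
    then show ?case using X_pow_B[of "Suc i" c n] by (intro tri_assign) (auto simp: mult.commute)
  next
    case 4
    show ?case using par_k_bounds(1)[of c n] par_L_less_X(2)[of n c] by (intro less_B) linarith
  qed (use that in auto)
  let ?I4 = "\<lambda>i s'. fst s' 0 = int n \<and> fst s' 1 = int ?h \<and> fst s' 3 = int ?k \<and>
    fst s' 2 = int ?X \<and> fst s' 6 = int ?X ^ (?k * ?k) \<and> fst s' 4 = 2 ^ i \<and> snd s' = snd s"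
  have hX: "?h ^ (c + 2) < ?X" using pow_less_par_X[of "c + 2" c n] by simp
  have w4: "tri ?B (For 10 (pow_expr (Reg 1) (c + 2)) (Assign 4 (Plus (Reg 4) (Reg 4)))) s'
     (?h ^ (c + 2) * (1 + 2) + 2) (?I4 (?h ^ (c + 2)))" if "?I4 0 s'" for s'
  proof (rule tri_for[of ?I4], goal_cases)
    case (2 i s1)
    have "(2::int) ^ Suc i < 2 ^ ?B" using 2(1) hX by (intro two_pow_less_B) linarith
    then show ?case using 2 by (intro tri_assign) auto
  next
    case (3 i s1)
    then have "fst s1 1 = int ?h" by simp
    then show ?case by (simp only: eval_pow_expr eval.simps of_nat_power)
  next
    case 4
    show ?case using hX by (intro less_B) simp
  qed (use that in auto)
  have nn: "int (n * n) < 2 ^ ?B" using par_L_less_X(4)[of n c] by (intro less_B) simp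
  show ?thesis unfolding n setup_prog_def
  proof (rule tri_seq[OF tri_assign[OF _ tri_seq[OF tri_assign[OF _ tri_seq[OF tri_post[OF w1]]]]]], goal_cases)
    case (4 s1)
    show ?case
    proof (rule tri_seq[OF tri_assign[OF _ tri_seq[OF tri_post[OF w2]]]], goal_cases)
      case (3 s2)
      show ?case
      proof (rule tri_seq[OF tri_assign[OF _ tri_seq[OF tri_post[OF w3]]]], goal_cases)
        case (3 s3)
        show ?case
        proof (rule tri_seq[OF tri_assign[OF _ tri_seq[OF tri_post[OF w4]]]], goal_cases)
          case (3 s4)
          then show ?case
            by (intro tri_assign) (use nn in \<open>auto simp: ready_def par_Z_def\<close>)
        qed (use 3 B1 in auto)
      qed (use 3 B1 in auto)
    qed (use 4 XX XB in auto)
  qed (use s B1 hB in auto)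
qed

section \<open>The table of small permanents\<close>

definition decode :: prog where
  "decode = Seq (Assign 16 (Reg 5)) (For 17 (Times (Reg 3) (Reg 3))
     (Seq (Store (Plus (Reg 12) (Reg 17)) (Modulo (Reg 16) (Reg 2)))
          (Assign 16 (Divide (Reg 16) (Reg 2)))))"

lemma tri_decode:
  assumes r: "fst s 5 = int i" "fst s 3 = int K" "fst s 2 = int X" "fst s 12 = b"
    and X: "0 < X" and B: "int X < 2 ^ B" "int i < 2 ^ B" "int (K * K) < 2 ^ B"
  shows "tri B decode s (K * K * 4 + 3) (\<lambda>s'. (\<forall>r<16. fst s' r = fst s r) \<and>
    mat_at b K (\<lambda>u v. int i div int X ^ (u * K + v) mod int X) s' \<and> (\<forall>a. a < b \<longrightarrow> snd s' a = snd s a))"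
proof -
  let ?I = "\<lambda>j s'. (\<forall>r<16. fst s' r = fst s r) \<and> fst s' 16 = int i div int X ^ j \<and>
    (\<forall>a<j. snd s' (b + int a) = int i div int X ^ a mod int X) \<and> (\<forall>a. a < b \<longrightarrow> snd s' a = snd s a)"
  let ?Q = "\<lambda>s'. (\<forall>r<16. fst s' r = fst s r) \<and>
    mat_at b K (\<lambda>u v. int i div int X ^ (u * K + v) mod int X) s' \<and> (\<forall>a. a < b \<longrightarrow> snd s' a = snd s a)"
  have For: "tri B (For 17 (Times (Reg 3) (Reg 3))
     (Seq (Store (Plus (Reg 12) (Reg 17)) (Modulo (Reg 16) (Reg 2)))
          (Assign 16 (Divide (Reg 16) (Reg 2))))) s' (K * K * (1 + 1 + 2) + 2) ?Q" if "?I 0 s'" for s'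
  proof (rule tri_for[of ?I], goal_cases)
    case (2 j s1)
    have m: "\<bar>int i div int X ^ j mod int X\<bar> < 2 ^ B"
      using X B(1) pos_mod_bound[of "int X" "int i div int X ^ j"] pos_mod_sign[of "int X" "int i div int X ^ j"] by linarith
    have d: "\<bar>int i div int X ^ j div int X\<bar> < 2 ^ B"
      using abs_div_le[of "int i div int X ^ j" "int X"] abs_div_le[of "int i" "int X ^ j"] B(2) by linarith
    have e: "int i div int X ^ j div int X = int i div int X ^ Suc j"
      by (simp add: zdiv_zmult2_eq[symmetric] mult.commute)
    show ?case
      by (rule tri_seq[OF tri_store[OF _ tri_assign]]) (use 2 r m d e in \<open>auto simp: less_Suc_eq\<close>)
  next
    case (5 s1)
    then show ?case by (auto simp: mat_at_def)
  qed (use that r B in auto)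
  have "tri B decode s (1 + (K * K * (1 + 1 + 2) + 2)) ?Q"
    unfolding decode_def
    by (rule tri_seq[OF tri_assign[OF _ For[THEN tri_post]]]) (use r B in auto)
  then show ?thesis by (rule tri_le) simp
qed

text \<open>Elimination down to \<open>K = 0\<close> leaves the empty permanent, so the leaf is the
  constant \<open>1\<close>. The decoded matrix starts at \<open>2 * n * n\<close>, behind the input
  and the working copy.\<close>

definition table_body :: prog where
  "table_body = Seq (Assign 10 (Reg 3)) (Seq (Assign 11 (Const 0)) (Seq (Assign 12 (Plus (Reg 9) (Reg 9)))
     (Seq decode (Seq (all_subsets (Assign 50 (Const 1))) (Store (Minus (Const (- 1)) (Reg 5)) (Reg 22))))))"

lemma tri_table:
  assumes s: "ready c n s"
  defines "k \<equiv> par_k c n"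
  shows "tri (par_B c n) (For 5 (Reg 6) table_body) s
    (par_X c n ^ (k * k) * (k * k * 4 + 2 ^ k * (3 * (k * k) + k * (4 * (k * k) + 8) + 11) + 4 * k + 18) + 2)
    (\<lambda>s'. ready c n s' \<and> (\<forall>a. 0 \<le> a \<and> a < int (n * n) \<longrightarrow> snd s' a = snd s a) \<and>
       table_at (par_X c n ^ (k * k)) k (par_X c n) s')"
proof -
  let ?B = "par_B c n" let ?X = "par_X c n" let ?Z = "par_Z c n"
  let ?I = "\<lambda>i s'. ready c n s' \<and> (\<forall>a. 0 \<le> a \<and> a < int (n * n) \<longrightarrow> snd s' a = snd s a) \<and> table_at i k ?X s'"
  have k: "k \<le> n" "k * k \<le> n" unfolding k_def using par_k_bounds(1,2)[of c n] by auto
  have kn: "int (k * k) \<le> int (n * n)" using k(1) by (simp only: of_nat_le_iff mult_le_mono)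
  have X: "0 < ?X" "int ?X < 2 ^ ?B" using par_L_less_X(2)[of n c] less_B[of ?X c n] by auto
  have nB: "int (n * n + n * n) < 2 ^ ?B"
  proof (rule less_B)
    have "n * n + n * n \<le> (n + 2) ^ 2 * 2" by (simp add: power2_eq_square algebra_simps)
    then show "n * n + n * n \<le> ?X" using pow_less_par_X[of 2 c n] by linarith
  qed
  have kB: "int k < 2 ^ ?B" "int (k * k) < 2 ^ ?B"
    using k par_L_less_X(2)[of n c] by (intro less_B; linarith)+
  have kB2: "(2::int) ^ k < 2 ^ ?B" using k(1) par_L_less_X(2)[of n c] by (intro two_pow_less_B) linarith
  have B1: "\<bar>1::int\<bar> < 2 ^ ?B" "\<bar>0::int\<bar> < 2 ^ ?B" using le_par_B(2)[of c n] by auto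
  have Z1: "1 < ?Z" unfolding par_Z_def by (rule one_less_power) simp_all
  have ZB: "?Z ^ Suc (k - 0) < 2 ^ ?B" using k by (intro Z_pow_B) simp
  have cB: "int i < 2 ^ ?B" if "i < ?X ^ (k * k)" for i
  proof -
    have "int i < int ?X ^ (k * k)" using that by (metis of_nat_less_iff of_nat_power)
    also have "\<dots> < 2 ^ ?B" unfolding k_def by (rule X_pow_B) simp
    finally show ?thesis .
  qed
  have body: "tri ?B table_body s'
      (1 + (1 + (1 + (k * k * 4 + 3 +
        (2 ^ (k - 0) * (3 * (k * k) + (k - 0) * (4 * (k * k) + 8) + 1 + 10) + 4 * (k - 0) + 9 + 1)))))
      (\<lambda>s''. fst s'' 5 = int i \<and> ?I (Suc i) ((fst s'')(5 := int i + 1), snd s''))"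
    if i: "i < ?X ^ (k * k)" and I: "?I i s'" and i5: "fst s' 5 = int i" for i s'
  proof -
    let ?W = "\<lambda>u v. int i div int ?X ^ (u * k + v) mod int ?X"
    let ?b = "int (n * n)" let ?d = "int (n * n + n * n)"
    have r: "fst s' 0 = int n" "fst s' 2 = int ?X" "fst s' 3 = int k" "fst s' 4 = ?Z" "fst s' 9 = ?b"
      using I unfolding ready_def k_def by auto
    have ready_cong: "ready c n t" if "\<And>r. r < 10 \<Longrightarrow> r \<noteq> 5 \<Longrightarrow> fst t r = fst s' r" for t
      using I that unfolding ready_def by simp
    show ?thesis unfolding table_body_def
    proof (rule tri_seq[OF tri_assign[OF _ tri_seq[OF tri_assign[OF _ tri_seq[OF tri_assign[OF _
          tri_seq[OF tri_post[OF tri_decode[of _ i k ?X ?d]]]]]]]]], goal_cases)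
      case (12 s1)
      show ?case
      proof (rule tri_seq, rule tri_post[OF tri_all_subsets[where N = k and K = 0 and b = ?b and Z = ?Z and W = ?W and c = 1]], goal_cases)
        case (13 s2 W2)
        show ?case by (rule tri_assign) (use B1 in auto)
      next
        case (14 s2)
        have r2: "fst s2 r = fst s' r" if "r < 10" for r using 14 12 that by simp
        have "0 \<le> ?W u v \<and> ?W u v < int ?X" for u v using X by simp
        then have p: "fst s2 22 = perm k ?W" using 14 small_perm[of c n ?W] by (simp add: k_def)
        have m2: "snd s2 a = snd s' a" if a: "a < ?b" for a
        proof -
          have "a < int (n * n) + int (n * n)" using a by linarith
          then have "a < 2 * (int n * int n)" by simp
          then show ?thesis using 14 12 a by simp
        qed
        have t: "table_at (Suc i) k ?X (f, (snd s2)(- 1 - int i := perm k ?W))" for f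
          unfolding table_at_def
        proof (intro allI impI)
          fix j assume "j < Suc i"
          then consider "j = i" | "j < i" by linarith
          then show "snd (f, (snd s2)(- 1 - int i := perm k ?W)) (- 1 - int j) =
              perm k (\<lambda>u v. int j div int ?X ^ (u * k + v) mod int ?X)"
          proof cases
            case 2
            have "snd s2 (- 1 - int j) = snd s' (- 1 - int j)" by (intro m2) linarith
            then show ?thesis using I 2 by (simp add: table_at_def)
          qed simp
        qed
        show ?case
        proof (rule tri_bd, rule tri_store, goal_cases)
          case 1
          then show ?case by (simp add: bd_def)
        next
          case 2
          have "ready c n ((fst s2)(5 := int i + 1), (snd s2)(- 1 - int i := perm k ?W))"
            by (rule ready_cong) (use r2 in auto)
          then show ?case using r2[of 5] p t i5 m2 I by auto
        qed
      qed (use 12 r Z1 ZB kB kB2 kn in auto)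
    qed (use r X kB nB cB[OF i] B1 i5 in auto)
  qed
  have Xk: "int (?X ^ (k * k)) < 2 ^ ?B" using X_pow_B[of "k * k" c n] by (simp add: k_def)
  have "tri ?B (For 5 (Reg 6) table_body) s (?X ^ (k * k) * (1 + (1 + (1 + (k * k * 4 + 3 +
        (2 ^ (k - 0) * (3 * (k * k) + (k - 0) * (4 * (k * k) + 8) + 1 + 10) + 4 * (k - 0) + 9 + 1)))) + 2) + 2)
      (\<lambda>s'. ready c n s' \<and> (\<forall>a. 0 \<le> a \<and> a < int (n * n) \<longrightarrow> snd s' a = snd s a) \<and>
       table_at (par_X c n ^ (k * k)) k (par_X c n) s')"
  proof (rule tri_for[of ?I], goal_cases)
    case (2 i s')
    then show ?case by (intro body) auto
  next
    case 1
    show ?case using s by (simp add: ready_def table_at_def)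
  next
    case (3 i s')
    then show ?case by (simp add: ready_def k_def)
  qed (use Xk in auto)
  then show ?thesis by (rule tri_le) (simp add: algebra_simps)
qed

section \<open>The complete algorithm and its correctness\<close>

definition permanent_prog :: "nat \<Rightarrow> prog" where
  "permanent_prog c = Seq (setup_prog c) (Seq (For 5 (Reg 6) table_body)
     (Seq (Assign 10 (Reg 0)) (Seq (Assign 11 (Reg 3)) (Seq (Assign 12 (Const 0))
     (Seq (all_subsets crt)
       (Cond (Less (Plus (Reg 22) (Reg 22)) (Reg 4)) (Assign 0 (Reg 22)) (Assign 0 (Minus (Reg 22) (Reg 4)))))))))"

definition steps :: "nat \<Rightarrow> nat \<Rightarrow> nat" where
  "steps c n = (let k = par_k c n; X = par_X c n in
     par_L n * 3 + k * 2 + k * k * 3 + (n + 2) ^ (c + 2) * 3 + 12 +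
     (X ^ (k * k) * (k * k * 4 + 2 ^ k * (3 * (k * k) + k * (4 * (k * k) + 8) + 11) + 4 * k + 18) + 2 +
     (1 + (1 + (1 + (2 ^ (n - k) * (3 * (n * n) + (n - k) * (4 * (n * n) + 8) +
        (X * (4 * (k * k) + 4 * X + 11) + 4) + 10) + 4 * (n - k) + 9 + 2))))))"

text \<open>A negative permanent appears as a residue in the upper half of the range.\<close>

lemma recenter:
  assumes "2 * \<bar>p\<bar> < (Z :: int)"
  shows "(if 2 * (p mod Z) < Z then p mod Z else p mod Z - Z) = p"
proof (cases "0 \<le> p")
  case True
  then have "p mod Z = p" using assms by simp
  then show ?thesis using assms True by simp
next
  case False
  have "p mod Z = (p + Z) mod Z" by simp
  also have "\<dots> = p + Z" using assms False by (intro mod_pos_pos_trivial) auto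
  finally show ?thesis using assms False by simp
qed

lemma tri_permanent_prog:
  assumes M: "M \<in> carrier_mat n n"
    and b: "\<And>i j. i < n \<Longrightarrow> j < n \<Longrightarrow> \<bar>M $$ (i, j)\<bar> \<le> 2 ^ ((n + 2) ^ c)"
  shows "tri (par_B c n) (permanent_prog c) (input_state n M) (steps c n) (\<lambda>s. result s = permanent M)"
proof -
  define k where "k = par_k c n"
  define W where "W = (\<lambda>i j. M $$ (i, j))"
  let ?B = "par_B c n" let ?X = "par_X c n" let ?Z = "par_Z c n" let ?s = "input_state n M"
  have k: "k \<le> n" "k * k \<le> n" unfolding k_def using par_k_bounds(1,2)[of c n] by auto
  have X: "0 < ?X" "int ?X < 2 ^ ?B" using par_L_less_X(2)[of n c] less_B[of ?X c n] by auto
  have nB: "int n < 2 ^ ?B" "int (n * n) < 2 ^ ?B"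
    using par_L_less_X(2,4)[of n c] by (intro less_B; linarith)+
  have kB: "int k < 2 ^ ?B" "int (k * k) < 2 ^ ?B"
    using k par_L_less_X(2)[of n c] by (intro less_B; linarith)+
  have mB: "(2::int) ^ (n - k) < 2 ^ ?B" using par_L_less_X(2)[of n c] by (intro two_pow_less_B) linarith
  have B1: "\<bar>0::int\<bar> < 2 ^ ?B" by auto
  have Z1: "1 < ?Z" unfolding par_Z_def by (rule one_less_power) simp_all
  have ZB: "?Z ^ Suc (n - k) < 2 ^ ?B" using k by (intro Z_pow_B) simp
  have ZB1: "?Z < 2 ^ ?B" using Z_pow_B[of 1 n c] by simp
  have Xk: "int ?X ^ (k * k) < 2 ^ ?B" unfolding k_def by (rule X_pow_B) simp
  have "int a < int n * int n" if "a < n * n" for a using that by (metis of_nat_less_iff of_nat_mult)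
  then have W: "mat_at 0 n W ?s" by (auto simp: mat_at_def input_state_def W_def)
  have p: "2 * \<bar>perm n W\<bar> < ?Z" by (rule full_perm) (use b in \<open>simp add: W_def\<close>)
  have perm: "permanent M = perm n W" unfolding W_def by (rule permanent_eq_perm[OF M])
  have s0: "fst ?s 0 = int n" "fst ?s 3 = 0" "fst ?s 7 = 0" by (auto simp: input_state_def)
  show ?thesis unfolding permanent_prog_def steps_def Let_def k_def[symmetric]
  proof (rule tri_seq[OF tri_post[OF tri_setup[OF s0, of c, folded k_def]]],
      rule tri_seq[OF tri_post[OF tri_table[of c n, folded k_def]]], goal_cases)
    case (2 s1 s2)
    then have r: "fst s2 0 = int n" "fst s2 2 = int ?X" "fst s2 3 = int k" "fst s2 4 = ?Z" "fst s2 9 = int (n * n)"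
      unfolding ready_def k_def by auto
    have W2: "mat_at 0 n W s2" unfolding mat_at_def
    proof (intro allI impI)
      fix a assume a: "a < n * n"
      then have "int a < int (n * n)" by (simp only: of_nat_less_iff)
      then have "snd s2 (int a) = snd ?s (int a)" using 2 by simp
      then show "snd s2 (0 + int a) = W (a div n) (a mod n)" using W a by (simp add: mat_at_def)
    qed
    have T2: "table_at (?X ^ (k * k)) k ?X s2" using 2 by simp
    have crt: "tri ?B crt s' (?X * (4 * (k * k) + 4 * ?X + 11) + 4)
        (\<lambda>s''. fst s'' 50 = perm k W' \<and> (\<forall>r<50. fst s'' r = fst s' r) \<and> snd s'' = snd s')"
      if "fst s' 2 = int ?X" "fst s' 3 = int k" "fst s' 9 = int (n * n)" "fst s' 10 = int n"
        "\<forall>a. a < int (n * n) \<longrightarrow> snd s' a = snd s2 a"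
        "mat_at (int (n * n)) n W' s'" "\<forall>u<n. \<forall>v<n. 0 \<le> W' u v \<and> W' u v < ?Z ^ Suc (n - k)" for s' W'
    proof (rule tri_crt[of s' ?X k _ n])
      \<comment> \<open>The table lies at negative addresses, outside the working copy, which is the
        only area that \<open>all_subsets\<close> overwrites.\<close>
      have "- 1 - int i < int (n * n)" for i by linarith
      then show "table_at (?X ^ (k * k)) k ?X s'"
        using T2 that(5) unfolding table_at_def by metis
      have "0 \<le> W' u v \<and> W' u v < ?Z ^ Suc (n - k)" if "u < k" "v < k" for u v
        using \<open>\<forall>u<n. \<forall>v<n. _\<close> that k by simp
      then show "0 \<le> perm k W'" "perm k W' < int (lcm_upto (?X - 1))"
        using lcm_greater[of c n W'] unfolding k_def by auto
    qed (use that r k X Xk kB lcm_less_B in auto)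
    have main: "tri ?B (all_subsets crt) s3
      (2 ^ (n - k) * (3 * (n * n) + (n - k) * (4 * (n * n) + 8) + (?X * (4 * (k * k) + 4 * ?X + 11) + 4) + 10) + 4 * (n - k) + 9)
      (\<lambda>s'. fst s' 22 = perm n W mod ?Z \<and> (\<forall>r<13. fst s' r = fst s3 r) \<and>
       (\<forall>a. a < int (n * n) \<or> int (n * n) + int (n * n) \<le> a \<longrightarrow> snd s' a = snd s3 a))"
      if s3: "\<And>r. r < 10 \<Longrightarrow> fst s3 r = fst s2 r" "fst s3 10 = int n" "fst s3 11 = int k" "fst s3 12 = 0"
        "snd s3 = snd s2" for s3
    proof (rule tri_all_subsets[where ?a0.0 = 0 and b = "int (n * n)" and Z = ?Z and N = n and K = k and W = W], goal_cases)
      case (13 s' W')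
      show ?case by (rule crt) (use 13 s3 r in auto)
    qed (use s3 r Z1 ZB nB mB k W2 in \<open>auto simp: mat_at_def\<close>)
    have fin: "tri ?B (Cond (Less (Plus (Reg 22) (Reg 22)) (Reg 4)) (Assign 0 (Reg 22)) (Assign 0 (Minus (Reg 22) (Reg 4))))
        s' (Suc 1) (\<lambda>s. result s = permanent M)"
      if "fst s' 22 = perm n W mod ?Z" "fst s' 4 = ?Z" for s'
    proof -
      have q: "0 \<le> perm n W mod ?Z" "perm n W mod ?Z < ?Z" using Z1 by auto
      show ?thesis
        by (rule tri_cond; rule tri_assign)
          (use that q ZB1 recenter[OF p] in \<open>auto simp: result_def perm split: if_splits\<close>)
    qed
    have e: "2 ^ (n - k) * (3 * (n * n) + (n - k) * (4 * (n * n) + 8) + (?X * (4 * (k * k) + 4 * ?X + 11) + 4) + 10) + 4 * (n - k) + 9 + 2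
      = 2 ^ (n - k) * (3 * (n * n) + (n - k) * (4 * (n * n) + 8) + (?X * (4 * (k * k) + 4 * ?X + 11) + 4) + 10) + 4 * (n - k) + 9 + Suc 1"
      by simp
    show ?case unfolding e
      by (rule tri_seq[OF tri_assign[OF _ tri_seq[OF tri_assign[OF _ tri_seq[OF tri_assign[OF _
          tri_seq[OF tri_post[OF main]]]]]]]])
        (use r nB kB fin in auto)
  qed simp
qed

section \<open>Running time\<close>

text \<open>With base \<open>n + 2 \<ge> 2\<close>, constant coefficients are absorbed by powers of
  the base, so one natural number \<open>c\<close> describes the bound for every
  \<open>n\<close>.\<close>

lemma poly_le_power: "\<exists>c. \<forall>n. poly b (real n) \<le> (real n + 2) ^ c"
proof (induction b)
  case 0
  show ?case by simp
next
  case (pCons a p)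
  then obtain c where c: "\<And>n. poly p (real n) \<le> (real n + 2) ^ c" by blast
  obtain d :: nat where d: "\<bar>a\<bar> < 2 ^ d" using real_arch_pow[of 2 "\<bar>a\<bar>"] by auto
  show ?case
  proof (intro exI allI)
    fix n :: nat
    let ?h = "real n + 2" let ?e = "c + d + 1"
    have "a \<le> ?h ^ d" using d power_mono[of 2 ?h d] by linarith
    also have "\<dots> \<le> ?h ^ (c + d)" by (intro power_increasing) auto
    finally have 1: "a \<le> ?h ^ (c + d)" .
    have "real n * poly p (real n) \<le> real n * ?h ^ c" using c by (intro mult_left_mono) auto
    also have "\<dots> \<le> real n * ?h ^ (c + d)" by (intro mult_left_mono power_increasing) auto
    finally have "poly (pCons a p) (real n) \<le> (real n + 1) * ?h ^ (c + d)"
      using 1 by (simp add: algebra_simps)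
    also have "\<dots> \<le> ?h * ?h ^ (c + d)" by (intro mult_right_mono) auto
    finally show "poly (pCons a p) (real n) \<le> ?h ^ ?e" by simp
  qed
qed

text \<open>Only the two exponential terms need care: the table, controlled by
  \<open>par_X_pow\<close>, and the sum over \<open>2 ^ (n - k)\<close> subsets. Every polynomial
  quantity is replaced by \<open>par_X c n\<close>.\<close>

lemma steps_le: "steps c n \<le> par_X c n ^ 7 * 2 ^ (n - par_k c n)"
proof -
  define X where "X = par_X c n"
  define k where "k = par_k c n"
  define P where "P = (2::nat) ^ (n - k)"
  have X3: "3 ^ 6 \<le> X"
  proof -
    have "(3::nat) ^ 6 \<le> 3 ^ (c + 6)" by (intro power_increasing) auto
    also have "\<dots> \<le> (n + 3) ^ (c + 6)" by (intro power_mono) auto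
    finally show ?thesis using par_X_gt[of n c] by (simp add: X_def)
  qed
  have b: "par_L n \<le> X" "n \<le> X" "k \<le> X" "k * k \<le> X" "n * n \<le> X" "(n + 2) ^ (c + 2) \<le> X" "n - k \<le> X"
    using par_L_less_X[of n c] par_k_bounds(1,2)[of c n] pow_less_par_X[of "c + 2" c n]
    by (auto simp: X_def k_def)
  have P1: "1 \<le> P" by (simp add: P_def)
  have "int (X ^ (k * k) * 2 ^ k) \<le> int P"
    using par_X_pow[of c n] by (simp add: X_def k_def P_def)
  then have XP: "X ^ (k * k) * 2 ^ k \<le> P" by (simp only: of_nat_le_iff)
  have s: "k * (4 * (k * k) + 8) \<le> X * (4 * X + 8)" "(n - k) * (4 * (n * n) + 8) \<le> X * (4 * X + 8)"
      "X * (4 * (k * k) + 4 * X + 11) \<le> X * (4 * X + 4 * X + 11)"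
    using b by (intro mult_le_mono; simp)+
  have "X ^ (k * k) * (k * k * 4 + 2 ^ k * (3 * (k * k) + k * (4 * (k * k) + 8) + 11) + 4 * k + 18)
      \<le> X ^ (k * k) * (2 ^ k * (4 * X + (3 * X + X * (4 * X + 8) + 11) + 4 * X + 18))"
  proof (rule mult_le_mono2)
    have "3 * (k * k) + k * (4 * (k * k) + 8) + 11 \<le> 3 * X + X * (4 * X + 8) + 11" using b s by linarith
    then have "2 ^ k * (3 * (k * k) + k * (4 * (k * k) + 8) + 11) \<le> 2 ^ k * (3 * X + X * (4 * X + 8) + 11)"
      by (rule mult_le_mono2)
    moreover have "k * k * 4 + 4 * k + 18 \<le> 2 ^ k * (4 * X + 4 * X + 18)"
      using mult_le_mono[of 1 "2 ^ k" "k * k * 4 + 4 * k + 18" "4 * X + 4 * X + 18"] b by simp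
    ultimately show "k * k * 4 + 2 ^ k * (3 * (k * k) + k * (4 * (k * k) + 8) + 11) + 4 * k + 18
      \<le> 2 ^ k * (4 * X + (3 * X + X * (4 * X + 8) + 11) + 4 * X + 18)"
      by (simp only: add_mult_distrib2)
  qed
  also have "\<dots> \<le> P * (4 * X + (3 * X + X * (4 * X + 8) + 11) + 4 * X + 18)"
    unfolding mult.assoc[symmetric] by (intro mult_le_mono1 XP)
  finally have t: "X ^ (k * k) * (k * k * 4 + 2 ^ k * (3 * (k * k) + k * (4 * (k * k) + 8) + 11) + 4 * k + 18)
     \<le> P * (4 * X * X + 19 * X + 29)" by (simp add: algebra_simps)
  have "3 * (n * n) + (n - k) * (4 * (n * n) + 8) + (X * (4 * (k * k) + 4 * X + 11) + 4) + 10
      \<le> 3 * X + X * (4 * X + 8) + (X * (4 * X + 4 * X + 11) + 4) + 10" using b(5) s(2,3) by linarith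
  also have "\<dots> = 12 * X * X + 22 * X + 14" by (simp add: algebra_simps)
  finally have m: "P * (3 * (n * n) + (n - k) * (4 * (n * n) + 8) + (X * (4 * (k * k) + 4 * X + 11) + 4) + 10)
     \<le> P * (12 * X * X + 22 * X + 14)"
    by (rule mult_le_mono2)
  have r: "par_L n * 3 + k * 2 + k * k * 3 + (n + 2) ^ (c + 2) * 3 + 12 + (2 + (3 + 4 * (n - k) + 11)) \<le> P * (15 * X + 28)"
    using mult_le_mono[OF P1, of "par_L n * 3 + k * 2 + k * k * 3 + (n + 2) ^ (c + 2) * 3 + 12 + (2 + (3 + 4 * (n - k) + 11))" "15 * X + 28"] b
    by simp
  have "steps c n \<le> P * (15 * X + 28) + P * (4 * X * X + 19 * X + 29) + P * (12 * X * X + 22 * X + 14)"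
    unfolding steps_def Let_def X_def[symmetric] k_def[symmetric] P_def[symmetric] using t m r by linarith
  also have "\<dots> = P * (16 * X * X + 56 * X + 71)" by (simp add: algebra_simps)
  also have "\<dots> \<le> P * X ^ 7"
  proof (rule mult_le_mono2)
    have "X \<le> X * X" by simp
    moreover have "71 \<le> X * X" using X3 mult_le_mono[of 9 X 9 X] by simp
    ultimately have "16 * X * X + 56 * X + 71 \<le> 73 * (X * X)" unfolding mult.assoc by linarith
    also have "\<dots> \<le> X * (X * X)" using X3 by (intro mult_le_mono1) simp
    also have "\<dots> = X ^ 3" by (simp add: eval_nat_numeral)
    also have "\<dots> \<le> X ^ 7" using X3 by (intro power_increasing) auto
    finally show "16 * X * X + 56 * X + 71 \<le> X ^ 7" .
  qed
  finally show ?thesis by (simp add: X_def P_def k_def mult.commute)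
qed

lemma par_B_le: "par_B c n \<le> (n + 2) ^ (3 * c + 19)"
proof -
  have "c + 6 < 2 ^ (c + 6)" by (rule less_exp)
  also have "\<dots> \<le> (n + 2) ^ (c + 6)" by (intro power_mono) auto
  finally have "par_L n * (c + 6) * par_X c n \<le> (n + 2) * (n + 2) ^ (c + 6) * (n + 2) ^ (2 * (c + 6))"
    by (intro mult_le_mono par_L_bounds par_X_le) simp
  also have "\<dots> = (n + 2) ^ (Suc (c + 6) + 2 * (c + 6))"
    by (simp only: power_Suc[symmetric] power_add[symmetric])
  also have "Suc (c + 6) + 2 * (c + 6) = 3 * c + 19" by simp
  finally show ?thesis by (simp add: par_B_def)
qed

lemma time_bound:
  "\<exists>E. \<forall>n. steps c n * wt (permanent_prog c) (par_B c n) \<le> (n + 2) ^ E * 2 ^ (n - par_k c n)"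
proof -
  obtain C where C: "\<And>B. 1 \<le> B \<Longrightarrow> wt (permanent_prog c) B \<le> C * B\<^sup>2" using wt_le by blast
  let ?E = "7 * (2 * (c + 6)) + C + 2 * (3 * c + 19)"
  show ?thesis
  proof (intro exI[of _ ?E] allI)
    fix n :: nat
    have gen: "(x ^ p * w) * x ^ q = x ^ (p + q) * w" for x w p q :: nat by (simp add: power_add)
    have "C < 2 ^ C" by (rule less_exp)
    also have "\<dots> \<le> (n + 2) ^ C" by (intro power_mono) auto
    finally have C': "C \<le> (n + 2) ^ C" by simp
    have "wt (permanent_prog c) (par_B c n) \<le> C * (par_B c n)\<^sup>2" by (intro C le_par_B)
    also have "\<dots> \<le> (n + 2) ^ C * ((n + 2) ^ (3 * c + 19))\<^sup>2"
      by (intro mult_le_mono C' power_mono par_B_le) simp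
    finally have w: "wt (permanent_prog c) (par_B c n) \<le> (n + 2) ^ (C + 2 * (3 * c + 19))"
      by (simp only: power_mult[symmetric] power_add[symmetric] mult.commute[of _ 2])
    have "steps c n \<le> ((n + 2) ^ (2 * (c + 6))) ^ 7 * 2 ^ (n - par_k c n)"
      by (rule le_trans[OF steps_le]) (intro mult_le_mono1 power_mono par_X_le, simp)
    also have "((n + 2) ^ (2 * (c + 6))) ^ 7 = (n + 2) ^ (7 * (2 * (c + 6)))"
      by (simp only: power_mult[symmetric] mult.commute[of _ 7])
    finally have "steps c n * wt (permanent_prog c) (par_B c n) \<le>
        ((n + 2) ^ (7 * (2 * (c + 6))) * 2 ^ (n - par_k c n)) * (n + 2) ^ (C + 2 * (3 * c + 19))"
      using w by (rule mult_le_mono)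
    also have "\<dots> = (n + 2) ^ ?E * 2 ^ (n - par_k c n)"
      unfolding add.assoc[of "7 * (2 * (c + 6))"] by (rule gen)
    finally show "steps c n * wt (permanent_prog c) (par_B c n) \<le> (n + 2) ^ ?E * 2 ^ (n - par_k c n)" .
  qed
qed

text \<open>By the choice of \<open>par_k\<close>, its successor violates the size condition;
  solving that inequality for \<open>k\<close> and bounding \<open>par_L n\<close> by a logarithm
  gives the estimate.\<close>

lemma par_k_ge: "sqrt (real n / (2 * (real c + 6) * (log 2 (real n + 2) + 1))) - 1 \<le> real (par_k c n)"
proof -
  let ?L = "par_L n" let ?l = "log 2 (real n + 2) + 1" let ?k = "par_k c n"
  have pos: "0 < 2 * (real c + 6) * ?l" by (intro mult_pos_pos add_nonneg_pos) auto
  have "2 powr real ?L \<le> 2 * (real n + 2)"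
    using par_L_bounds(1)[of n] by (simp add: powr_realpow flip: of_nat_le_iff[where 'a = real])
  then have "real ?L \<le> log 2 (2 * (real n + 2))" by (subst le_log_iff) auto
  also have "log 2 (2 * (real n + 2)) = log 2 2 + log 2 (real n + 2)" by (rule log_mult_pos) auto
  finally have L: "real ?L \<le> ?l" by simp
  have "real n \<le> real (2 * (c + 6) * ?L * (?k + 1)\<^sup>2)"
    using par_k_less[of n c] by (simp only: of_nat_le_iff)
  also have "\<dots> = 2 * (real c + 6) * real ?L * (real ?k + 1)\<^sup>2" by (simp add: algebra_simps)
  also have "\<dots> \<le> 2 * (real c + 6) * ?l * (real ?k + 1)\<^sup>2"
    using L by (intro mult_right_mono mult_left_mono) auto
  finally have "real n / (2 * (real c + 6) * ?l) \<le> (real ?k + 1)\<^sup>2"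
    by (simp only: pos_divide_le_eq[OF pos] mult.commute)
  then have "sqrt (real n / (2 * (real c + 6) * ?l)) \<le> real ?k + 1"
    by (intro real_le_lsqrt) auto
  then show ?thesis by simp
qed

text \<open>The loss \<open>e * log 2 (n + 2)\<close> from polynomial factors is of lower order than
  the square root, so the quotient still has a positive limit.\<close>

lemma exponent_bigomega:
  fixes a e :: real
  assumes "a > 0"
  defines "g \<equiv> \<lambda>n :: nat. sqrt (real n / (a * (log 2 (real n + 2) + 1))) - 1 - e * log 2 (real n + 2)"
  assumes f: "\<And>n. g n \<le> f n"
  shows "f \<in> \<Omega>(\<lambda>n. sqrt (real n / log 2 (real n)))" "eventually (\<lambda>n. 0 \<le> f n) sequentially"
proof -
  \<comment> \<open>The limit is \<open>1 / sqrt a\<close>; \<open>ln 2\<close> enters through the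
    base of the logarithm and cancels.\<close>
  define l where "l = (inverse a * ln 2) powr (1 / 2) * inverse (ln 2 powr (1 / 2))"
  have "(\<lambda>n. g n / sqrt (real n / log 2 (real n))) \<longlonglongrightarrow> l"
    unfolding g_def l_def using assms(1) by real_asymp
  have pos: "eventually (\<lambda>n. sqrt (real n / log 2 (real n)) > 0) sequentially" by real_asymp
  define d where "d = l / 2"
  have "l > 0" using assms(1) by (simp add: l_def)
  then have d: "d > 0" "d < l" by (auto simp: d_def)
  have "eventually (\<lambda>n. d < g n / sqrt (real n / log 2 (real n))) sequentially"
    by (rule order_tendstoD) fact+
  with pos have "eventually (\<lambda>n. d * sqrt (real n / log 2 (real n)) \<le> f n \<and> 0 \<le> sqrt (real n / log 2 (real n))) sequentially"
  proof eventually_elim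
    case (elim n)
    then have "d * sqrt (real n / log 2 (real n)) < g n" by (simp only: pos_less_divide_eq)
    then show ?case using f[of n] elim by linarith
  qed
  then have ev: "eventually (\<lambda>n. d * sqrt (real n / log 2 (real n)) \<le> f n \<and>
     0 \<le> d * sqrt (real n / log 2 (real n)) \<and> 0 \<le> sqrt (real n / log 2 (real n))) sequentially"
    by eventually_elim (use d in \<open>auto intro!: mult_nonneg_nonneg\<close>)
  then show "eventually (\<lambda>n. 0 \<le> f n) sequentially" by eventually_elim linarith
  show "f \<in> \<Omega>(\<lambda>n. sqrt (real n / log 2 (real n)))"
  proof (rule landau_omega.bigI[OF d(1)])
    show "eventually (\<lambda>n. d * norm (sqrt (real n / log 2 (real n))) \<le> norm (f n)) sequentially"
      using ev by eventually_elim (simp only: real_norm_def abs_of_nonneg, linarith)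
  qed
qed

theorem theorem1:
  fixes b :: "real poly"
  shows "\<exists>(P :: prog) (f :: nat \<Rightarrow> real).
    f \<in> \<Omega>(\<lambda>n. sqrt (real n / log 2 (real n))) \<and> eventually (\<lambda>n. 0 \<le> f n) sequentially \<and>
    (\<forall>n. \<forall>M \<in> carrier_mat n n.
      (\<forall>i<n. \<forall>j<n. real_of_int (bitlen \<bar>M $$ (i, j)\<bar>) \<le> poly b (real n)) \<longrightarrow>
      (\<exists>t s. exec P (input_state n M) t s \<and> result s = permanent M \<and>
             real t \<le> 2 powr (real n - f n)))"
proof -
  obtain c where c: "\<And>n. poly b (real n) \<le> (real n + 2) ^ c" using poly_le_power by blast
  obtain E where E: "\<And>n. steps c n * wt (permanent_prog c) (par_B c n) \<le> (n + 2) ^ E * 2 ^ (n - par_k c n)"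
    using time_bound by blast
  \<comment> \<open>The polynomial factor \<open>(n + 2) ^ E\<close> is written as
    \<open>2 powr (E * log 2 (n + 2))\<close> and charged against the gain. For small
    \<open>n\<close> this can make \<open>f\<close> negative.\<close>
  define f where "f n = real (par_k c n) - real E * log 2 (real n + 2)" for n
  have f: "f \<in> \<Omega>(\<lambda>n. sqrt (real n / log 2 (real n)))" "eventually (\<lambda>n. 0 \<le> f n) sequentially"
    by (rule exponent_bigomega[of "2 * (real c + 6)" "real E"]; use par_k_ge[of _ c] in \<open>force simp: f_def\<close>)+
  have time: "real ((n + 2) ^ E * 2 ^ (n - par_k c n)) = 2 powr (real n - f n)" for n
  proof -
    have "real ((n + 2) ^ E) = 2 powr (real E * log 2 (real n + 2))"
      by (simp add: powr_realpow[symmetric] powr_powr[symmetric] powr_mult mult.commute[of "real E"] add.commute)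
    moreover have "real (2 ^ (n - par_k c n)) = 2 powr (real n - real (par_k c n))"
      using par_k_bounds(2)[of c n] by (simp add: powr_realpow[symmetric] of_nat_diff)
    moreover have "real n - f n = real E * log 2 (real n + 2) + (real n - real (par_k c n))"
      by (simp add: f_def)
    ultimately show ?thesis by (simp only: of_nat_mult powr_add)
  qed
  show ?thesis
  proof (intro exI[of _ "permanent_prog c"] exI[of _ f] conjI f allI ballI impI)
    fix n M assume M: "M \<in> carrier_mat n n"
      and bits: "\<forall>i<n. \<forall>j<n. real_of_int (bitlen \<bar>M $$ (i, j)\<bar>) \<le> poly b (real n)"
    have entry: "\<bar>M $$ (i, j)\<bar> < 2 ^ ((n + 2) ^ c)" if "i < n" "j < n" for i j
    proof -
      have "real_of_int (bitlen \<bar>M $$ (i, j)\<bar>) \<le> (real n + 2) ^ c"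
        using bits that c[of n] by force
      also have "\<dots> = real_of_int (int ((n + 2) ^ c))" by (simp add: add.commute)
      finally have "bitlen \<bar>M $$ (i, j)\<bar> \<le> int ((n + 2) ^ c)" by (simp only: of_int_le_iff)
      then show ?thesis by (simp only: bitlen_le_iff_power nat_int)
    qed
    \<comment> \<open>The judgement says something only about states within the size bound, so the
      input has to satisfy it.\<close>
    have "bd (par_B c n) (input_state n M)"
    proof -
      have "(2::int) ^ ((n + 2) ^ c) < 2 ^ par_B c n"
        using pow_less_par_X[of c c n] by (intro two_pow_less_B) simp
      then have "\<bar>M $$ (nat a div n, nat a mod n)\<bar> < 2 ^ par_B c n" if "0 \<le> a" "a < int n * int n" for a
      proof -
        have "nat a < n * n" using that by (simp add: nat_less_iff)
        then have "nat a div n < n" "nat a mod n < n"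
          by (auto simp: less_mult_imp_div_less intro!: mod_less_divisor gr0I)
        then show ?thesis using entry \<open>_ < 2 ^ par_B c n\<close> by (meson less_trans)
      qed
      moreover have "int n < 2 ^ par_B c n" using par_L_less_X(2)[of n c] by (intro less_B) simp
      ultimately show ?thesis by (auto simp: bd_def input_state_def)
    qed
    with tri_permanent_prog[OF M, of c] entry obtain t s where
      *: "exec (permanent_prog c) (input_state n M) t s" "result s = permanent M"
        "t \<le> steps c n * wt (permanent_prog c) (par_B c n)"
      unfolding tri_def by (meson less_imp_le)
    have "t \<le> (n + 2) ^ E * 2 ^ (n - par_k c n)" using *(3) E by (rule le_trans)
    then have "real t \<le> 2 powr (real n - f n)" unfolding time[symmetric] by (simp only: of_nat_le_iff)
    with * show "\<exists>t s. exec (permanent_prog c) (input_state n M) t s \<and> result s = permanent M \<and>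
        real t \<le> 2 powr (real n - f n)" by blast
  qed
qed

end
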